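(* Let $n\geq2$. For $\mu_n$-almost every $L\in X_n$, $\sigma_L$ equals the unique number $\sigma>\frac n2$ which satisfies $$2\,m(L)^{-2\sigma}=\tfrac12\,\zeta(2\sigma)^{-1}E_n(L,\sigma).$$ It follows that for $\mu_n$-almost every $L\in X_n$, $E_n(L,s)$ has infinitely many zeros with $\Re s>\frac n2$.
   Context: $X_n$ is the space of all lattices $L\subset\mathbb{R}^n$ of covolume one, identified with $\mathrm{SL}(n,\mathbb{Z})\backslash\mathrm{SL}(n,\mathbb{R})$ (where $\mathrm{SL}(n,\mathbb{Z})g$ corresponds to $\mathbb{Z}^ng$), and $\mu_n$ is the probability measure on $X_n$ induced from Haar measure on $\mathrm{SL}(n,\mathbb{R})$ (Siegel's measure). For $L\in X_n$, $E_n(L,s)=\sum_{v\in L\setminus\{0\}}|v|^{-2s}$ for $\Re s>\frac n2$, extended meromorphically to $\mathbb{C}$ (with a single, simple, pole at $s=\frac n2$), and $\sigma_L:=\sup\{\Re\rho : E_n(L,\rho)=0\}$. $m(L)$ is the length of the shortest non-zero vector in $L$, and $\zeta$ is the Riemann zeta function. *)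

theory Defs
  imports "HOL-Probability.Probability" "HOL-Complex_Analysis.Complex_Analysis"
begin

definition SL :: "(real^'n^'n) set" where
  "SL = {g. det g = 1}"

text \<open>Lattices consist of row vectors, so that left multiplication of \<open>g\<close> by an element of
  \<open>SL(n,\<int>)\<close> does not change \<open>\<int>\<^sup>n g\<close>.\<close>

definition lattice_of :: "real^'n^'n \<Rightarrow> (real^'n) set" where
  "lattice_of g = {z v* g | z. \<forall>i. z $ i \<in> \<int>}"

text \<open>The covolume of \<open>\<int>\<^sup>n g\<close> is \<open>\<bar>det g\<bar>\<close>; changing the sign of one basis vector if necessary,
  every lattice of covolume one is \<open>\<int>\<^sup>n g\<close> with \<open>det g = 1\<close>.\<close>

definition unimodular_lattices :: "(real^'n) set set" where
  "unimodular_lattices = lattice_of ` SL"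

definition haar_measure_SL :: "(real^'n^'n) measure \<Rightarrow> bool" where
  "haar_measure_SL H \<longleftrightarrow>
     sets H = sets (restrict_space borel SL) \<and>
     (\<forall>g\<in>SL. \<forall>A\<in>sets H. emeasure H ((\<lambda>x. g ** x) ` A) = emeasure H A) \<and>
     (\<forall>K. compact K \<longrightarrow> K \<subseteq> SL \<longrightarrow> emeasure H K < \<infinity>) \<and>
     emeasure H SL \<noteq> 0"

text \<open>The measurable sets are the Borel sets of the quotient of \<open>SL(n,\<real>)\<close> by \<open>SL(n,\<int>)\<close>, i.e. the sets
  with Borel preimage in \<open>SL(n,\<real>)\<close>. The last clause is the quotient integral formula
  \<open>\<integral>\<^sub>G f dH = \<integral>\<^sub>X (\<Sum>\<gamma>\<in>SL(n,\<int>). f (\<gamma> g)) d\<mu>(\<int>\<^sup>n g)\<close> for indicator functions \<open>f = 1\<^sub>B\<close>: the inner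
  sum is the number of points of \<open>B\<close> in the fibre over the lattice. As \<open>H\<close> is determined up to
  a scalar, the normalisation of \<open>\<mu>\<close> makes \<open>\<mu>\<close> unique.\<close>

definition siegel_measure :: "(real^'n) set measure \<Rightarrow> bool" where
  "siegel_measure \<mu> \<longleftrightarrow>
     prob_space \<mu> \<and>
     sets \<mu> = {A. A \<subseteq> unimodular_lattices \<and>
                  {g \<in> SL. lattice_of g \<in> A} \<in> sets (restrict_space borel SL)} \<and>
     (\<exists>H. haar_measure_SL H \<and>
        (\<forall>B\<in>sets H. emeasure H B =
           (\<integral>\<^sup>+ L. emeasure (count_space UNIV) {g \<in> B. lattice_of g = L} \<partial>\<mu>)))"

text \<open>The meromorphic extension of \<open>f\<close> from the open set \<open>D\<close> to the whole plane. Being nicely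
  meromorphic (value \<open>0\<close> at poles, no removable singularities) makes the extension unique
  for nonempty \<open>D\<close>; on \<open>D\<close> it is \<open>f\<close> itself.\<close>

definition meromorphic_extension :: "complex set \<Rightarrow> (complex \<Rightarrow> complex) \<Rightarrow> complex \<Rightarrow> complex" where
  "meromorphic_extension D f s =
     (if s \<in> D then f s
      else (THE g. g nicely_meromorphic_on UNIV \<and> (\<forall>z\<in>D. g z = f z)) s)"

definition riemann_zeta :: "complex \<Rightarrow> complex" where
  "riemann_zeta =
     meromorphic_extension {s. Re s > 1} (\<lambda>s. \<Sum>k. 1 / of_nat (Suc k) powr s)"

definition epstein_zeta :: "(real^'n) set \<Rightarrow> complex \<Rightarrow> complex" where
  "epstein_zeta L =
     meromorphic_extension {s. Re s > real CARD('n) / 2}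
       (\<lambda>s. \<Sum>\<^sub>\<infinity>v\<in>L - {0}. complex_of_real (norm v) powr (- 2 * s))"

text \<open>Poles are excluded explicitly because the extension takes the value \<open>0\<close> there.\<close>

definition epstein_zeros :: "(real^'n) set \<Rightarrow> complex set" where
  "epstein_zeros L = {\<rho>. \<not> is_pole (epstein_zeta L) \<rho> \<and> epstein_zeta L \<rho> = 0}"

definition epstein_sigma :: "(real^'n) set \<Rightarrow> ereal" where
  "epstein_sigma L = (SUP \<rho>\<in>epstein_zeros L. ereal (Re \<rho>))"

definition shortest_length :: "(real^'n) set \<Rightarrow> real" where
  "shortest_length L = (INF v\<in>L - {0}. norm v)"

end

theory Submission
  imports Defs "HOL-Computational_Algebra.Fundamental_Theorem_Algebra" "HOL-Real_Asymp.Real_Asymp"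
begin

text \<open>Let \<open>p\<^sub>0\<close> be a shortest vector of \<open>L\<close>, of length \<open>m\<close>. For \<open>Re s > n / 2\<close>, grouping lattice vectors by the
  primitive vector they are a multiple of gives \<open>E(L, s) = \<zeta>(2s) m\<^sup>-\<^sup>2\<^sup>s (2 + Z(2s))\<close>, where
  \<open>Z(s) = \<Sum> (\<bar>p\<bar> / m)\<^sup>-\<^sup>s\<close> over the primitive vectors \<open>p \<noteq> \<plusminus>p\<^sub>0\<close>, and the equation for \<open>\<sigma>\<close> says \<open>Z(2\<sigma>) = 2\<close>.
  For almost every \<open>L\<close> the logarithms of the lengths of pairwise non-parallel lattice vectors are
  linearly independent over the rationals. Then \<open>\<bar>p\<bar> > m\<close> in \<open>Z\<close>, so \<open>Z\<close> decreases strictly on the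
  real axis, from infinity to \<open>0\<close>, and equals \<open>2\<close> exactly once, at \<open>2\<sigma>\<^sub>0\<close>; to the right of \<open>\<sigma>\<^sub>0\<close> there is
  no zero because \<open>\<bar>Z\<bar> < 2\<close>. By Kronecker's theorem there are arbitrarily large \<open>t\<close> with
  \<open>Z(s + it)\<close> uniformly close to \<open>- Z(s)\<close>, and since \<open>2 - Z\<close> vanishes at \<open>2\<sigma>\<^sub>0\<close>, Hurwitz's theorem yields
  zeros of \<open>2 + Z\<close> with real part close to \<open>2\<sigma>\<^sub>0\<close> and arbitrarily large imaginary part. Only the half plane
  of absolute convergence matters, so the analytic continuation plays no role.\<close>

section \<open>Null sets for Haar measure\<close>

text \<open>The identity plus a matrix of rank at most one. For \<open>w\<close> orthogonal to
  \<open>u\<close> it is unipotent and additive in \<open>t\<close>, and along its orbits the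
  squared length of every vector is a polynomial of degree at most two in \<open>t\<close>. With
  \<open>w = u\<close> reflections also have this shape.\<close>

definition transvection :: "real^'n \<Rightarrow> real^'n \<Rightarrow> real \<Rightarrow> real^'n^'n" where
  "transvection u w t = (\<chi> i j. (if i = j then 1 else 0) + t * u $ i * w $ j)"

lemma vector_matrix_mult_transvection:
  "z v* transvection u w t = z + (t * (z \<bullet> u)) *\<^sub>R w"
  by (simp add: transvection_def vector_matrix_mult_def vec_eq_iff inner_vec_def distrib_right
      sum.distrib if_distrib[of "\<lambda>x. _ * x"] distrib_left sum_distrib_left sum_distrib_right mult_ac cong: if_cong)

lemma matrix_eq_vector_matrix_mult:
  fixes A B :: "real^'n^'n"
  assumes "\<And>z. z v* A = z v* B"
  shows "A = B"
proof -
  have "transpose A = transpose B"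
    unfolding matrix_eq using assms by (metis transpose_transpose vector_transpose_matrix)
  then show ?thesis by (metis transpose_transpose)
qed

lemma transvection_mult:
  fixes u w :: "real^'n"
  assumes "w \<bullet> u = 0"
  shows "transvection u w s ** transvection u w t = transvection u w (s + t)"
  by (rule matrix_eq_vector_matrix_mult)
    (simp add: vector_matrix_mul_assoc[symmetric] vector_matrix_mult_transvection inner_add_left assms algebra_simps)

lemma transvection_0: "transvection u w 0 = mat 1"
  by (rule matrix_eq_vector_matrix_mult) (simp add: vector_matrix_mult_transvection)

text \<open>The reflection \<open>D\<close> along \<open>u\<close> conjugates the transvection with parameter \<open>t\<close> into its inverse, so
  its determinant is \<open>\<plusminus>1\<close>; it is also the square of the determinant for \<open>t / 2\<close>.\<close>
lemma det_transvection:
  fixes u w :: "real^'n"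
  assumes "w \<bullet> u = 0"
  shows "det (transvection u w t) = 1"
proof (cases "u = 0")
  case True
  then have "transvection u w t = mat 1"
    by (intro matrix_eq_vector_matrix_mult) (simp add: vector_matrix_mult_transvection)
  then show ?thesis by simp
next
  case False
  define D where "D = transvection u u (- 2 / (u \<bullet> u))"
  have uu: "u \<bullet> u \<noteq> 0" using False by simp
  have D: "z v* D = z - (2 * (z \<bullet> u) / (u \<bullet> u)) *\<^sub>R u" for z
    by (simp add: D_def vector_matrix_mult_transvection)
  have Du: "(z v* D) \<bullet> u = - (z \<bullet> u)" for z
    using uu by (simp add: D inner_diff_left)
  have "D ** D = mat 1"
    by (rule matrix_eq_vector_matrix_mult)
      (simp add: vector_matrix_mul_assoc[symmetric] D[of "_ v* D"] Du, simp add: D)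
  then have "det D * det D = 1" by (metis det_I det_mul)
  then have "det D \<noteq> 0" by auto
  moreover have "D ** transvection u w t = transvection u w (- t) ** D"
    by (rule matrix_eq_vector_matrix_mult)
      (simp add: vector_matrix_mul_assoc[symmetric] vector_matrix_mult_transvection D
        inner_diff_left inner_add_left assms uu)
  then have "det D * det (transvection u w t) = det (transvection u w (- t)) * det D"
    by (metis det_mul)
  ultimately have "det (transvection u w t) = det (transvection u w (- t))" by simp
  moreover have "det (transvection u w t) * det (transvection u w (- t)) = 1"
    by (metis add.right_inverse assms det_I det_mul transvection_0 transvection_mult)
  ultimately have "(det (transvection u w t))\<^sup>2 = 1" by (simp add: power2_eq_square)
  moreover have "det (transvection u w t) = (det (transvection u w (t / 2)))\<^sup>2"
    using transvection_mult[OF assms, of "t/2" "t/2"] by (metis det_mul field_sum_of_halves power2_eq_square)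
  ultimately show ?thesis
    by (metis power2_eq_1_iff zero_le_power2 not_one_le_zero neg_0_le_iff_le)
qed

lemma transvection_SL:
  fixes u w :: "real^'n"
  shows "w \<bullet> u = 0 \<Longrightarrow> g \<in> SL \<Longrightarrow> transvection u w t ** g \<in> SL"
  by (simp add: SL_def det_mul det_transvection)

section \<open>Haar measure of sets to which orbits return finitely often\<close>

lemma continuous_on_vector_matrix_mult:
  "continuous_on S (\<lambda>g::real^'n^'n. z v* g)"
  unfolding vector_matrix_mult_def by (intro continuous_intros)

lemma continuous_on_matrix_mult:
  fixes f g :: "'a::topological_space \<Rightarrow> real^'n^'n"
  assumes "continuous_on S f" "continuous_on S g"
  shows "continuous_on S (\<lambda>x. f x ** g x)"
  unfolding matrix_matrix_mult_def by (intro continuous_intros assms)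

lemma continuous_on_transvection: "continuous_on S (\<lambda>t. transvection u w t)"
  unfolding transvection_def by (intro continuous_intros)

lemma closed_SL: "closed (SL :: (real^'n^'n) set)"
proof -
  have "closed {g::real^'n^'n. det g = 1}"
    unfolding det_def by (intro closed_Collect_eq continuous_intros)
  then show ?thesis by (simp add: SL_def)
qed

lemma sets_haar_measure_SL:
  assumes "haar_measure_SL H"
  shows "A \<in> sets H \<longleftrightarrow> A \<in> sets borel \<and> A \<subseteq> SL"
proof -
  have "SL \<in> sets (borel :: (real^'n^'n) measure)" by (rule borel_closed[OF closed_SL])
  then have "A \<in> sets (restrict_space borel SL) \<longleftrightarrow> A \<in> sets borel \<and> A \<subseteq> SL"
    by (subst sets_restrict_space_iff) auto
  then show ?thesis using assms by (simp add: haar_measure_SL_def)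
qed

text \<open>If a bounded piece of \<open>S\<close> had positive measure, infinitely many of its translates, all of the same
  measure, would lie in one compact set, so some point would lie in infinitely many of them.\<close>
lemma haar_null_if_finite_returns:
  fixes u w :: "real^'n"
  assumes H: "haar_measure_SL H" and wu: "w \<bullet> u = 0" and S: "S \<in> sets H"
    and fin: "\<And>g. g \<in> SL \<Longrightarrow> finite {t. transvection u w t ** g \<in> S}"
  shows "emeasure H S = 0"
proof -
  have SLsub: "S \<subseteq> SL" "S \<in> sets borel" using S sets_haar_measure_SL[OF H] by auto
  have "emeasure H (S \<inter> cball 0 (real R)) = 0" for R
  proof -
    define A where "A = S \<inter> cball 0 (real R)"
    have A: "A \<in> sets H" "A \<subseteq> SL" "A \<subseteq> S" using SLsub sets_haar_measure_SL[OF H] by (auto simp: A_def)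
    \<comment> \<open>The parameters are pairwise distinct, so a point in infinitely many translates
      returns to \<open>S\<close> infinitely often; they are bounded, so all translates stay in the
      compact set \<open>K\<close> below.\<close>
    define h where "h = (\<lambda>k. transvection u w (1 / real (Suc k)))"
    define h' where "h' = (\<lambda>k. transvection u w (- 1 / real (Suc k)))"
    have hh': "h k ** h' k = mat 1" "h' k ** h k = mat 1" for k
      using transvection_mult[OF wu] transvection_0 by (simp_all add: h_def h'_def)
    define B where "B = (\<lambda>k. (\<lambda>x. h' k ** x) ` A)"
    have B_iff: "x \<in> B k \<longleftrightarrow> h k ** x \<in> A" for x k
    proof
      assume "x \<in> B k"
      then show "h k ** x \<in> A" by (auto simp: B_def matrix_mul_assoc hh')
    next
      assume "h k ** x \<in> A"
      then have "h' k ** (h k ** x) \<in> B k" unfolding B_def by (rule imageI)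
      then show "x \<in> B k" by (simp add: matrix_mul_assoc hh')
    qed
    have BSL: "B k \<subseteq> SL" for k
      using A transvection_SL[OF wu] by (auto simp: B_def h'_def)
    have Bm: "B k \<in> sets H" for k
    proof -
      have "continuous_on UNIV (\<lambda>x :: real^'n^'n. h k ** x)"
        by (rule continuous_on_matrix_mult[OF continuous_on_const continuous_on_id])
      then have "(\<lambda>x :: real^'n^'n. h k ** x) \<in> borel_measurable borel"
        by (rule borel_measurable_continuous_onI)
      then have "(\<lambda>x :: real^'n^'n. h k ** x) -` A \<inter> space borel \<in> sets borel"
        by (rule measurable_sets) (use A sets_haar_measure_SL[OF H] in auto)
      also have "(\<lambda>x :: real^'n^'n. h k ** x) -` A \<inter> space borel = B k" using B_iff by auto
      finally show ?thesis using BSL sets_haar_measure_SL[OF H] by auto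
    qed
    have eqB: "emeasure H (B k) = emeasure H A" for k
    proof -
      have "h' k \<in> SL" by (simp add: h'_def SL_def det_transvection wu)
      then show ?thesis using H A(1) by (simp add: B_def haar_measure_SL_def)
    qed
    define K where "K = (\<lambda>(t, x). transvection u w t ** x) ` ({-1..0} \<times> (SL \<inter> cball 0 (real R)))"
    have "compact K" unfolding K_def
    proof (intro compact_continuous_image compact_Times)
      show "continuous_on ({-1..0} \<times> (SL \<inter> cball 0 (real R))) (\<lambda>(t, x). transvection u w t ** x)"
        unfolding case_prod_beta
        by (intro continuous_on_matrix_mult continuous_intros
            continuous_on_compose2[OF continuous_on_transvection[of UNIV]]) auto
    qed (auto intro: closed_Int_compact closed_SL)
    moreover have KSL: "K \<subseteq> SL" using transvection_SL[OF wu] by (auto simp: K_def)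
    ultimately have Kfin: "emeasure H K < \<infinity>" "K \<in> sets H"
      using H sets_haar_measure_SL[OF H, of K] by (auto simp: haar_measure_SL_def compact_imp_closed)
    have BK: "B k \<subseteq> K" for k
    proof
      fix x assume "x \<in> B k"
      then obtain y where "y \<in> A" "x = h' k ** y" by (auto simp: B_def)
      moreover have "(- 1 / real (Suc k)) \<in> {-1..0}" by (auto simp: field_simps)
      ultimately show "x \<in> K" using A
        unfolding K_def h'_def by (intro image_eqI[of _ _ "(- 1 / real (Suc k), y)"]) (auto simp: A_def)
    qed
    \<comment> \<open>The sets \<open>C n\<close> decrease to the set of points lying in infinitely
      many \<open>B k\<close>, which is empty. Continuity from above applies because
      \<open>K\<close> has finite measure, while each \<open>C n\<close> has at least the measure of
      \<open>A\<close>.\<close>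
    define C where "C = (\<lambda>n. \<Union>k\<in>{n..}. B k)"
    have Cm: "C n \<in> sets H" for n using Bm by (auto simp: C_def)
    have "(\<Inter>n. C n) = {}"
    proof (rule ccontr)
      assume "(\<Inter>n. C n) \<noteq> {}"
      then obtain x where x: "\<And>n. x \<in> C n" by auto
      have "\<exists>k\<ge>n. x \<in> B k" for n using x[of n] by (auto simp: C_def)
      then have "infinite {k. x \<in> B k}"
        unfolding infinite_nat_iff_unbounded_le by auto
      moreover have "finite {k. x \<in> B k}"
      proof (rule finite_imageD)
        show "finite ((\<lambda>k. 1 / real (Suc k)) ` {k. x \<in> B k})"
        proof (rule finite_subset)
          show "(\<lambda>k. 1 / real (Suc k)) ` {k. x \<in> B k} \<subseteq> {t. transvection u w t ** x \<in> S}"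
            using A B_iff by (auto simp: h_def)
          show "finite {t. transvection u w t ** x \<in> S}"
            using x[of 0] BSL by (intro fin) (auto simp: C_def)
        qed
      qed (auto simp: inj_on_def)
      ultimately show False by simp
    qed
    moreover have "(\<lambda>n. emeasure H (C n)) \<longlonglongrightarrow> emeasure H (\<Inter>n. C n)"
    proof (rule Lim_emeasure_decseq)
      have "emeasure H (C n) \<le> emeasure H K" for n
        using BK Kfin by (intro emeasure_mono) (auto simp: C_def)
      then show "emeasure H (C n) \<noteq> \<infinity>" for n
        using Kfin(1) by (metis infinity_ennreal_def leD less_top top_neq_ennreal top.not_eq_extremum)
      show "decseq C" by (force simp: decseq_def C_def)
    qed (use Cm in auto)
    moreover have "emeasure H A \<le> emeasure H (C n)" for n
    proof -
      have "emeasure H A = emeasure H (B n)" by (simp add: eqB)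
      also have "\<dots> \<le> emeasure H (C n)" using Cm by (intro emeasure_mono) (auto simp: C_def)
      finally show ?thesis .
    qed
    ultimately have "emeasure H A \<le> emeasure H {}"
      by (metis LIMSEQ_le_const)
    then show ?thesis by (simp add: A_def)
  qed
  moreover have "S \<inter> cball 0 (real R) \<in> sets H" for R
    using SLsub sets_haar_measure_SL[OF H] by auto
  ultimately have "emeasure H (\<Union>R. S \<inter> cball 0 (real R)) = 0"
    by (subst emeasure_UN_eq_0) auto
  moreover have "(\<Union>R. S \<inter> cball 0 (real R)) = S"
    by (auto simp: real_arch_simple)
  ultimately show ?thesis by simp
qed

section \<open>Null sets of multiplicative relations between lengths\<close>

text \<open>Finitely many hyperplanes form a Lebesgue null set and so cannot cover the
  space.\<close>

lemma exists_not_orthogonal: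
  fixes A :: "(real^'n) set"
  assumes "finite A" "0 \<notin> A"
  obtains u where "\<And>a. a \<in> A \<Longrightarrow> a \<bullet> u \<noteq> 0"
proof -
  have "negligible (\<Union>a\<in>A. {x. a \<bullet> x = 0})"
  proof (rule negligible_Union)
    show "finite ((\<lambda>a. {x. a \<bullet> x = 0}) ` A)" using assms by simp
    show "negligible t" if "t \<in> (\<lambda>a. {x. a \<bullet> x = 0}) ` A" for t
      using that assms by (auto intro!: negligible_hyperplane)
  qed
  then have "(\<Union>a\<in>A. {x. a \<bullet> x = 0}) \<noteq> UNIV"
    using non_negligible_UNIV by metis
  then show ?thesis using that by auto
qed

lemma vector_matrix_mult_SL_eq_0:
  assumes "g \<in> SL"
  shows "w v* g = 0 \<longleftrightarrow> w = 0"
proof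
  assume *: "w v* g = 0"
  have "invertible g" using assms by (simp add: SL_def invertible_det_nz)
  then obtain g' where "g ** g' = mat 1" by (auto simp: invertible_def)
  then have "w = (w v* g) v* g'" by (simp add: vector_matrix_mul_assoc)
  then show "w = 0" by (simp add: *)
qed simp

text \<open>Written in Horner form, so that it matches the evaluation of a polynomial given by its
  list of coefficients.\<close>

lemma norm_transvection_squared:
  fixes u w z :: "real^'n"
  shows "(norm (z v* (transvection u w t ** g)))\<^sup>2 =
    (norm (z v* g))\<^sup>2 + t * (2 * (z \<bullet> u) * ((z v* g) \<bullet> (w v* g)) + t * ((z \<bullet> u)\<^sup>2 * (norm (w v* g))\<^sup>2))"
proof -
  have "z v* (transvection u w t ** g) = z v* g + (t * (z \<bullet> u)) *\<^sub>R (w v* g)"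
    by (simp add: vector_matrix_mul_assoc[symmetric] vector_matrix_mult_transvection
        vector_matrix_left_distrib scaleR_vector_matrix_assoc)
  then show ?thesis
    unfolding power2_norm_eq_inner
    by (simp add: inner_add_left inner_add_right inner_commute algebra_simps power2_eq_square)
qed

lemma borel_measurable_norm_vector_matrix_mult:
  "(\<lambda>g::real^'n^'n. norm (z v* g)) \<in> borel_measurable borel"
  by (intro borel_measurable_continuous_onI continuous_on_norm continuous_on_vector_matrix_mult)

text \<open>Along an orbit the difference of the squared norms is a polynomial in \<open>t\<close>
  whose quadratic coefficient is a positive multiple of
  \<open>(a \<bullet> u)^2 - (b \<bullet> u)^2\<close>. It is nonzero once \<open>u\<close> is
  orthogonal to neither \<open>a - b\<close> nor \<open>a + b\<close>, so returns are finite in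
  number. Dimension at least two provides \<open>w\<close>.\<close>

lemma null_sets_equal_norms:
  fixes a b :: "real^'n"
  assumes H: "haar_measure_SL H" and card: "CARD('n) \<ge> 2" and "a \<noteq> b" "a \<noteq> - b"
  shows "{g \<in> SL. norm (a v* g) = norm (b v* g)} \<in> null_sets H"
proof -
  let ?S = "{g \<in> SL. norm (a v* g) = norm (b v* g)}"
  obtain u where u: "(a - b) \<bullet> u \<noteq> 0" "(a + b) \<bullet> u \<noteq> 0"
  proof (rule exists_not_orthogonal)
    show "0 \<notin> {a - b, a + b}" using assms by (auto simp: eq_neg_iff_add_eq_0)
  qed auto
  obtain w :: "real^'n" where w: "w \<noteq> 0" "w \<bullet> u = 0"
    using orthogonal_to_vector_exists[of u] card by (auto simp: orthogonal_def inner_commute)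
  have "?S = SL \<inter> {g. norm (a v* g) = norm (b v* g)}" by auto
  also have "closed \<dots>"
    by (intro closed_Int closed_SL closed_Collect_eq continuous_intros continuous_on_vector_matrix_mult)
  finally have S: "?S \<in> sets H"
    using sets_haar_measure_SL[OF H] by (auto simp: borel_closed)
  have "emeasure H ?S = 0"
  proof (rule haar_null_if_finite_returns[OF H w(2) S])
    fix g :: "real^'n^'n" assume g: "g \<in> SL"
    define W where "W = (norm (w v* g))\<^sup>2"
    define p where "p = [: (norm (a v* g))\<^sup>2 - (norm (b v* g))\<^sup>2,
      2 * (a \<bullet> u) * ((a v* g) \<bullet> (w v* g)) - 2 * (b \<bullet> u) * ((b v* g) \<bullet> (w v* g)),
      ((a \<bullet> u)\<^sup>2 - (b \<bullet> u)\<^sup>2) * W :]"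
    have "W \<noteq> 0" using g w by (simp add: W_def vector_matrix_mult_SL_eq_0)
    moreover have "(a \<bullet> u)\<^sup>2 \<noteq> (b \<bullet> u)\<^sup>2"
      using u by (auto simp: power2_eq_iff inner_diff_left inner_add_left)
    ultimately have "p \<noteq> 0" by (simp add: p_def)
    then have "finite {t. poly p t = 0}" by (rule poly_roots_finite)
    moreover have "poly p t = (norm (a v* (transvection u w t ** g)))\<^sup>2
        - (norm (b v* (transvection u w t ** g)))\<^sup>2" for t
      unfolding p_def W_def norm_transvection_squared by (simp add: algebra_simps)
    ultimately show "finite {t. transvection u w t ** g \<in> ?S}"
      by (elim rev_finite_subset) auto
  qed
  with S show ?thesis by blast
qed

text \<open>The polynomial is \<open>|p + t c w|^2\<close>, evaluated at a complex \<open>t\<close>.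
  A real root gives \<open>p = - t c w\<close>. For a nonreal root this is Vieta's formula for the
  product of the root and its conjugate, obtained here from real and imaginary parts.\<close>

lemma complex_root_of_norm_squared:
  fixes p w :: "'a::real_inner" and c :: real
  assumes "complex_of_real ((norm p)\<^sup>2) + \<rho> * (of_real (2 * c * (p \<bullet> w)) + \<rho> * of_real (c\<^sup>2 * (norm w)\<^sup>2)) = 0"
  shows "(norm p)\<^sup>2 = (norm \<rho>)\<^sup>2 * (c\<^sup>2 * (norm w)\<^sup>2)"
proof -
  define x y B W where "x = Re \<rho>" "y = Im \<rho>" "B = p \<bullet> w" "W = (norm w)\<^sup>2"
  note defs = this
  have re: "(norm p)\<^sup>2 + x * (2 * c * B) + (x\<^sup>2 - y\<^sup>2) * (c\<^sup>2 * W) = 0"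
    using arg_cong[OF assms, of Re] by (simp add: defs algebra_simps power2_eq_square)
  have im: "y * (2 * c * B) + 2 * x * y * (c\<^sup>2 * W) = 0"
    using arg_cong[OF assms, of Im] by (simp add: defs algebra_simps power2_eq_square)
  have nrho: "(norm \<rho>)\<^sup>2 = x\<^sup>2 + y\<^sup>2" by (simp add: defs cmod_power2)
  show ?thesis
  proof (cases "y = 0")
    case True
    have "(norm (p + (x * c) *\<^sub>R w))\<^sup>2 = (norm p)\<^sup>2 + x * (2 * c * B) + x\<^sup>2 * (c\<^sup>2 * W)"
      unfolding power2_norm_eq_inner defs
      by (simp add: inner_add_left inner_add_right inner_commute algebra_simps power2_eq_square)
    also have "\<dots> = 0" using re True by simp
    finally have "p = - ((x * c) *\<^sub>R w)" by (simp add: eq_neg_iff_add_eq_0)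
    then have "(norm p)\<^sup>2 = (x * c)\<^sup>2 * W" by (simp add: defs power_mult_distrib)
    then show ?thesis using True nrho by (simp add: defs power_mult_distrib algebra_simps)
  next
    case False
    have "y * (2 * c * B + 2 * x * (c\<^sup>2 * W)) = 0" using im by (simp add: algebra_simps)
    then have "2 * c * B = - (2 * x * (c\<^sup>2 * W))"
      unfolding eq_neg_iff_add_eq_0 using False mult_eq_0_iff by blast
    then have "(norm p)\<^sup>2 + x * (- (2 * x * (c\<^sup>2 * W))) + (x\<^sup>2 - y\<^sup>2) * (c\<^sup>2 * W) = 0"
      using re by metis
    moreover have "x * (- (2 * x * k)) + (x\<^sup>2 - y\<^sup>2) * k = - ((x\<^sup>2 + y\<^sup>2) * k)" for k
      by (simp add: algebra_simps power2_eq_square)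
    ultimately have "(norm p)\<^sup>2 = (x\<^sup>2 + y\<^sup>2) * (c\<^sup>2 * W)"
      by (metis add.assoc add.right_neutral add_minus_cancel eq_neg_iff_add_eq_0 neg_equal_iff_equal)
    then show ?thesis by (simp add: nrho defs)
  qed
qed

text \<open>Parallel vectors always produce relations between logarithms of lengths:
  \<open>v\<close>, \<open>2 v\<close>, \<open>4 v\<close> satisfy
  \<open>ln |v| - 2 ln |2 v| + ln |4 v| = 0\<close>, and \<open>v\<close> and \<open>- v\<close>
  have equal length.\<close>

definition nonparallel :: "(real^'n) set \<Rightarrow> bool" where
  "nonparallel A \<longleftrightarrow> 0 \<notin> A \<and> pairwise (\<lambda>v w. \<forall>c. v \<noteq> c *\<^sub>R w) A"

definition log_relation :: "(real^'n) set \<Rightarrow> (real^'n \<Rightarrow> int) \<Rightarrow> (real^'n^'n) set" where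
  "log_relation A m = {g \<in> SL. (\<Sum>z\<in>A. of_int (m z) * ln (norm (z v* g))) = 0}"

text \<open>After exponentiation, a relation along an orbit \<open>t \<mapsto> transvection u w t ** g\<close> is an identity
  between products of powers of the quadratic polynomials \<open>t \<mapsto> \<bar>z h\<^sub>t g\<bar>\<^sup>2\<close>. A complex root of
  the polynomial for \<open>z\<^sub>1\<close> is, by the non-coincidence assumption, not a root of any other.\<close>
lemma finite_log_relation_returns:
  fixes u w :: "real^'n"
  assumes A: "finite A" "0 \<notin> A" and z1: "z1 \<in> A" "m z1 \<noteq> 0" and g: "g \<in> SL"
    and wu: "w \<bullet> u = 0" "w \<noteq> 0" and u: "\<And>z. z \<in> A \<Longrightarrow> z \<bullet> u \<noteq> 0"
    and ne: "\<And>z. z \<in> A \<Longrightarrow> z \<noteq> z1 \<Longrightarrow>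
      (norm (z v* g))\<^sup>2 * (z1 \<bullet> u)\<^sup>2 \<noteq> (norm (z1 v* g))\<^sup>2 * (z \<bullet> u)\<^sup>2"
  shows "finite {t. transvection u w t ** g \<in> log_relation A m}"
proof -
  define Q where "Q = (\<lambda>z. [: complex_of_real ((norm (z v* g))\<^sup>2),
     of_real (2 * (z \<bullet> u) * ((z v* g) \<bullet> (w v* g))), of_real ((z \<bullet> u)\<^sup>2 * (norm (w v* g))\<^sup>2) :])"
  have Q_real: "poly (Q z) (of_real t) = of_real ((norm (z v* (transvection u w t ** g)))\<^sup>2)" for z t
    unfolding norm_transvection_squared Q_def by simp
  have W: "w v* g \<noteq> 0" using g wu by (simp add: vector_matrix_mult_SL_eq_0)
  have Q_root: "(norm (z v* g))\<^sup>2 = (norm \<rho>)\<^sup>2 * ((z \<bullet> u)\<^sup>2 * (norm (w v* g))\<^sup>2)" if "poly (Q z) \<rho> = 0" for z \<rho>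
    using that by (intro complex_root_of_norm_squared) (simp add: Q_def)
  \<comment> \<open>Positive and negative coefficients are put on different sides, so that all
    exponents are natural numbers.\<close>
  define P where "P = (\<Prod>z\<in>A. Q z ^ nat (m z)) - (\<Prod>z\<in>A. Q z ^ nat (- m z))"
  have "degree (Q z1) = 2" using u[OF z1(1)] W by (simp add: Q_def)
  then obtain \<rho> where \<rho>: "poly (Q z1) \<rho> = 0"
    using fundamental_theorem_of_algebra[of "Q z1"] constant_degree[of "Q z1"] by auto
  have \<rho>': "poly (Q z) \<rho> \<noteq> 0" if "z \<in> A" "z \<noteq> z1" for z
  proof
    assume "poly (Q z) \<rho> = 0"
    from ne[OF that] Q_root[OF this] Q_root[OF \<rho>] show False by simp
  qed
  \<comment> \<open>According to the sign of \<open>m z1\<close>, the factor \<open>Q z1\<close>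
    occurs in exactly one of the two products; that product vanishes at \<open>\<rho>\<close> and
    the other does not.\<close>
  have "P \<noteq> 0"
  proof
    assume "P = 0"
    then have "poly (\<Prod>z\<in>A. Q z ^ nat (m z)) \<rho> = poly (\<Prod>z\<in>A. Q z ^ nat (- m z)) \<rho>"
      by (simp add: P_def)
    then have eq: "(\<Prod>z\<in>A. poly (Q z) \<rho> ^ nat (m z)) = (\<Prod>z\<in>A. poly (Q z) \<rho> ^ nat (- m z))"
      by (simp add: poly_prod poly_power)
    show False
    proof (cases "m z1 > 0")
      case True
      then have "(\<Prod>z\<in>A. poly (Q z) \<rho> ^ nat (m z)) = 0" using A z1 \<rho> by (auto intro!: prod_zero)
      moreover have "poly (Q z) \<rho> ^ nat (- m z) \<noteq> 0" if "z \<in> A" for z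
        using \<rho>'[OF that] True by (cases "z = z1") auto
      then have "(\<Prod>z\<in>A. poly (Q z) \<rho> ^ nat (- m z)) \<noteq> 0"
        using A by (simp add: prod_zero_iff)
      ultimately show False using eq by simp
    next
      case False
      then have "(\<Prod>z\<in>A. poly (Q z) \<rho> ^ nat (- m z)) = 0" using A z1 \<rho> by (auto intro!: prod_zero)
      moreover have "poly (Q z) \<rho> ^ nat (m z) \<noteq> 0" if "z \<in> A" for z
        using \<rho>'[OF that] False by (cases "z = z1") auto
      then have "(\<Prod>z\<in>A. poly (Q z) \<rho> ^ nat (m z)) \<noteq> 0"
        using A by (simp add: prod_zero_iff)
      ultimately show False using eq by simp
    qed
  qed
  then have "finite {s. poly P s = 0}" by (rule poly_roots_finite)
  then have "finite (complex_of_real -` {s. poly P s = 0})"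
    by (rule finite_vimageI) (simp add: inj_of_real)
  moreover have "poly P (of_real t) = 0" if t: "transvection u w t ** g \<in> log_relation A m" for t
  proof -
    define N where "N = (\<lambda>z. norm (z v* (transvection u w t ** g)))"
    have SL: "transvection u w t ** g \<in> SL" using g wu by (simp add: transvection_SL)
    have N: "N z > 0" if "z \<in> A" for z
      using vector_matrix_mult_SL_eq_0[OF SL, of z] that A(2) by (auto simp: N_def)
    have "(\<Sum>z\<in>A. of_int (m z) * ln (N z)) = 0" using t by (simp add: log_relation_def N_def)
    moreover have "real_of_int (m z) = real (nat (m z)) - real (nat (- m z))" for z by simp
    ultimately have "(\<Sum>z\<in>A. real (nat (m z)) * ln (N z)) = (\<Sum>z\<in>A. real (nat (- m z)) * ln (N z))"
      by (simp add: left_diff_distrib sum_subtractf del: of_nat_nat)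
    then have "(\<Sum>z\<in>A. ln (N z ^ nat (m z))) = (\<Sum>z\<in>A. ln (N z ^ nat (- m z)))"
      using N by (simp add: ln_realpow)
    then have "ln (\<Prod>z\<in>A. N z ^ nat (m z)) = ln (\<Prod>z\<in>A. N z ^ nat (- m z))"
      using N A by (subst (1 2) ln_prod) (auto dest!: N)
    then have "(\<Prod>z\<in>A. N z ^ nat (m z)) = (\<Prod>z\<in>A. N z ^ nat (- m z))"
      using N by (subst (asm) ln_inj_iff) (auto intro!: prod_pos)
    then have "(\<Prod>z\<in>A. N z ^ nat (m z))\<^sup>2 = (\<Prod>z\<in>A. N z ^ nat (- m z))\<^sup>2" by simp
    then have "(\<Prod>z\<in>A. ((N z)\<^sup>2) ^ nat (m z)) = (\<Prod>z\<in>A. ((N z)\<^sup>2) ^ nat (- m z))"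
      by (simp add: power2_eq_square power_mult_distrib prod.distrib)
    then have "complex_of_real (\<Prod>z\<in>A. ((N z)\<^sup>2) ^ nat (m z)) = of_real (\<Prod>z\<in>A. ((N z)\<^sup>2) ^ nat (- m z))"
      by simp
    then show ?thesis
      by (simp add: P_def poly_prod poly_power Q_real N_def)
  qed
  ultimately show ?thesis by (elim rev_finite_subset) auto
qed

text \<open>The non-coincidence condition of the orbit argument fails only on the null set
  \<open>S1\<close>, so it suffices to treat the relation outside \<open>S1\<close>.\<close>

lemma null_sets_log_relation:
  fixes A :: "(real^'n) set"
  assumes H: "haar_measure_SL H" and card: "CARD('n) \<ge> 2" and A: "finite A" "nonparallel A"
    and z1: "z1 \<in> A" "m z1 \<noteq> 0"
  shows "log_relation A m \<in> null_sets H"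
proof -
  have A0: "0 \<notin> A" using A by (simp add: nonparallel_def)
  obtain u where u: "\<And>z. z \<in> A \<Longrightarrow> z \<bullet> u \<noteq> 0"
    using exists_not_orthogonal[OF A(1) A0] by blast
  obtain w :: "real^'n" where w: "w \<noteq> 0" "w \<bullet> u = 0"
    using orthogonal_to_vector_exists[of u] card by (auto simp: orthogonal_def inner_commute)
  \<comment> \<open>On \<open>E z\<close> the quadratic polynomials belonging to \<open>z\<close>
    and \<open>z1\<close> have roots of the same modulus.\<close>
  define E where "E = (\<lambda>z. {g \<in> SL. norm (((z1 \<bullet> u) *\<^sub>R z) v* g) = norm (((z \<bullet> u) *\<^sub>R z1) v* g)})"
  define S1 where "S1 = (\<Union>z\<in>A - {z1}. E z)"
  have "S1 \<in> null_sets H" unfolding S1_def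
  proof (rule null_sets_UN')
    fix z assume z: "z \<in> A - {z1}"
    have *: "(z1 \<bullet> u) *\<^sub>R z \<noteq> d *\<^sub>R z1" for d
    proof
      assume "(z1 \<bullet> u) *\<^sub>R z = d *\<^sub>R z1"
      then have "z = (d / (z1 \<bullet> u)) *\<^sub>R z1"
        using u[OF z1(1)] by (metis divide_inverse_commute scaleR_scaleR left_inverse scaleR_one)
      then show False using A(2) z z1 by (auto simp: nonparallel_def pairwise_def)
    qed
    show "E z \<in> null_sets H"
      unfolding E_def using *[of "z \<bullet> u"] *[of "- (z \<bullet> u)"]
      by (intro null_sets_equal_norms[OF H card]) auto
  qed (use A in \<open>auto intro: countable_finite\<close>)
  define f where "f = (\<lambda>g::real^'n^'n. \<Sum>z\<in>A. of_int (m z) * ln (norm (z v* g)))"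
  have "f \<in> borel_measurable borel" unfolding f_def
    by (intro borel_measurable_sum borel_measurable_times borel_measurable_const borel_measurable_ln
        borel_measurable_norm_vector_matrix_mult)
  then have "f -` {0} \<inter> space borel \<in> sets borel"
    by (rule measurable_sets) auto
  then have "SL \<inter> (f -` {0} \<inter> space borel) \<in> sets borel"
    by (rule sets.Int[OF borel_closed[OF closed_SL]])
  also have "SL \<inter> (f -` {0} \<inter> space borel) = log_relation A m"
    by (auto simp: log_relation_def f_def)
  finally have S: "log_relation A m \<in> sets H"
    using sets_haar_measure_SL[OF H] by (auto simp: log_relation_def)
  then have SS1: "log_relation A m - S1 \<in> sets H" using \<open>S1 \<in> null_sets H\<close> by auto
  have "emeasure H (log_relation A m - S1) = 0"
  proof (rule haar_null_if_finite_returns[OF H w(2) SS1])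
    fix g :: "real^'n^'n" assume g: "g \<in> SL"
    show "finite {t. transvection u w t ** g \<in> log_relation A m - S1}"
    proof (cases "{t. transvection u w t ** g \<in> log_relation A m - S1} = {}")
      case False
      \<comment> \<open>Non-coincidence may fail at \<open>g\<close> itself, but it holds at the
        point of the orbit with parameter \<open>t0\<close>. The orbit is restarted there and the
        parameters are shifted back by \<open>t0\<close>.\<close>
      then obtain t0 where t0: "transvection u w t0 ** g \<notin> S1" by auto
      define g' where "g' = transvection u w t0 ** g"
      have g': "g' \<in> SL" using g w by (simp add: g'_def transvection_SL)
      have "finite {s. transvection u w s ** g' \<in> log_relation A m}"
      proof (rule finite_log_relation_returns[where m = m and ?z1.0 = z1, OF A(1) A0 z1 g' w(2,1) u])
        fix z assume z: "z \<in> A" "z \<noteq> z1"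
        then have "norm (((z1 \<bullet> u) *\<^sub>R z) v* g') \<noteq> norm (((z \<bullet> u) *\<^sub>R z1) v* g')"
          using t0 g' by (auto simp: S1_def E_def g'_def)
        then have "norm (z v* g') * \<bar>z1 \<bullet> u\<bar> \<noteq> norm (z1 v* g') * \<bar>z \<bullet> u\<bar>"
          by (simp add: scaleR_vector_matrix_assoc mult.commute)
        then have "(norm (z v* g') * \<bar>z1 \<bullet> u\<bar>)\<^sup>2 \<noteq> (norm (z1 v* g') * \<bar>z \<bullet> u\<bar>)\<^sup>2"
          by (subst power2_eq_iff_nonneg) auto
        then show "(norm (z v* g'))\<^sup>2 * (z1 \<bullet> u)\<^sup>2 \<noteq> (norm (z1 v* g'))\<^sup>2 * (z \<bullet> u)\<^sup>2"
          by (simp add: power_mult_distrib)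
      qed
      then have "finite ((\<lambda>s. s + t0) ` {s. transvection u w s ** g' \<in> log_relation A m})" by simp
      moreover have "transvection u w (t - t0) ** g' = transvection u w t ** g" for t
        using transvection_mult[OF w(2), of "t - t0" t0] by (simp add: g'_def matrix_mul_assoc)
      then have "{t. transvection u w t ** g \<in> log_relation A m - S1} \<subseteq>
        (\<lambda>s. s + t0) ` {s. transvection u w s ** g' \<in> log_relation A m}"
        by (auto intro!: image_eqI[of t "\<lambda>s. s + t0" "t - t0" for t])
      ultimately show ?thesis by (rule rev_finite_subset)
    next
      case True
      then show ?thesis by (metis finite.emptyI)
    qed
  qed
  then have "log_relation A m - S1 \<in> null_sets H" using SS1 by blast
  then have "(log_relation A m - S1) \<union> S1 \<in> null_sets H" using \<open>S1 \<in> null_sets H\<close> by (rule null_sets.Un)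
  then show ?thesis by (rule null_sets_subset) (use S in auto)
qed

section \<open>Logarithmic independence of almost every lattice\<close>

text \<open>Linear independence over the rationals with denominators cleared.\<close>

definition log_independent :: "(real^'n) set \<Rightarrow> bool" where
  "log_independent L \<longleftrightarrow> (\<forall>A m. finite A \<longrightarrow> A \<subseteq> L \<longrightarrow> nonparallel A \<longrightarrow>
     (\<Sum>v\<in>A. real_of_int (m v) * ln (norm v)) = 0 \<longrightarrow> (\<forall>v\<in>A. m v = 0))"

lemma inj_vector_matrix_mult_SL:
  assumes "g \<in> SL"
  shows "inj (\<lambda>z. z v* g)"
proof -
  have "invertible g" using assms by (simp add: SL_def invertible_det_nz)
  then obtain g' where "g ** g' = mat 1" by (auto simp: invertible_def)
  then have "z = (z v* g) v* g'" for z by (simp add: vector_matrix_mul_assoc)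
  then show ?thesis by (metis injI)
qed

lemma nonparallel_image_iff:
  assumes "g \<in> SL"
  shows "nonparallel ((\<lambda>z. z v* g) ` B) \<longleftrightarrow> nonparallel B"
proof -
  have "x v* g = c *\<^sub>R (y v* g) \<longleftrightarrow> x = c *\<^sub>R y" for x y c
    using inj_eq[OF inj_vector_matrix_mult_SL[OF assms], of x "c *\<^sub>R y"]
    by (simp add: scaleR_vector_matrix_assoc)
  moreover have "0 \<in> (\<lambda>z. z v* g) ` B \<longleftrightarrow> 0 \<in> B"
    using vector_matrix_mult_SL_eq_0[OF assms] by (force simp: image_iff)
  ultimately show ?thesis
    using inj_eq[OF inj_vector_matrix_mult_SL[OF assms]]
    by (auto simp: nonparallel_def pairwise_image pairwise_def)
qed

definition integer_vectors :: "(real^'n) set" where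
  "integer_vectors = {z. \<forall>i. z $ i \<in> \<int>}"

lemma lattice_of_eq_image: "lattice_of g = (\<lambda>z. z v* g) ` integer_vectors"
  by (auto simp: lattice_of_def integer_vectors_def)

lemma countable_integer_vectors: "countable (integer_vectors :: (real^'n) set)"
proof -
  have "z \<in> range (\<lambda>f::'n \<Rightarrow> int. \<chi> i. real_of_int (f i))" if "z \<in> integer_vectors" for z :: "real^'n"
  proof (rule image_eqI)
    show "z = (\<chi> i. real_of_int \<lfloor>z $ i\<rfloor>)"
      using that by (simp add: integer_vectors_def vec_eq_iff)
  qed simp
  then have "(integer_vectors :: (real^'n) set) \<subseteq> range (\<lambda>f::'n \<Rightarrow> int. \<chi> i. real_of_int (f i))"
    by blast
  then show ?thesis by (rule countable_subset) (rule countable_image[OF countableI_type])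
qed

text \<open>A failure is witnessed by integer vectors and integer coefficients, data that do not
  depend on \<open>g\<close>. The exceptional set is thus a countable union of null sets.\<close>

lemma null_sets_not_log_independent:
  assumes H: "haar_measure_SL (H :: (real^'n^'n) measure)" and card: "CARD('n) \<ge> 2"
  shows "{g \<in> SL. \<not> log_independent (lattice_of g)} \<in> null_sets H"
proof -
  \<comment> \<open>Coefficient functions are taken extensional on the finite set \<open>B\<close>;
    this makes the index set countable.\<close>
  define C :: "((real^'n) set \<times> (real^'n \<Rightarrow> int)) set" where
    "C = (SIGMA B:{B. finite B \<and> B \<subseteq> integer_vectors \<and> nonparallel B}.
            {m \<in> B \<rightarrow>\<^sub>E UNIV. \<exists>z\<in>B. m z \<noteq> 0})"
  have "{g \<in> SL. \<not> log_independent (lattice_of g)} = (\<Union>(B, m)\<in>C. log_relation B m)"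
  proof (intro equalityI subsetI)
    fix g :: "real^'n^'n" assume "g \<in> {g \<in> SL. \<not> log_independent (lattice_of g)}"
    then obtain A m v where g: "g \<in> SL" and A: "finite A" "A \<subseteq> lattice_of g" "nonparallel A"
      "(\<Sum>v\<in>A. real_of_int (m v) * ln (norm v)) = 0" "v \<in> A" "m v \<noteq> 0"
      by (auto simp: log_independent_def)
    note inj = inj_vector_matrix_mult_SL[OF g]
    obtain B where B: "B \<subseteq> integer_vectors" "A = (\<lambda>z. z v* g) ` B"
      using A(2) unfolding lattice_of_eq_image by (meson subset_imageE)
    define m' where "m' = restrict (\<lambda>z. m (z v* g)) B"
    have "finite B" using A(1) B(2) inj by (metis finite_imageD inj_on_subset subset_UNIV)
    moreover have "nonparallel B" using A(3) B(2) nonparallel_image_iff[OF g] by blast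
    moreover have "\<exists>z\<in>B. m' z \<noteq> 0" using A(5,6) B(2) by (auto simp: m'_def)
    ultimately have "(B, m') \<in> C" using B by (auto simp: C_def m'_def)
    moreover have "(\<Sum>z\<in>B. real_of_int (m' z) * ln (norm (z v* g))) = 0"
      using A(4) unfolding B(2) by (subst (asm) sum.reindex) (auto simp: m'_def intro: inj_on_subset[OF inj])
    then have "g \<in> log_relation B m'" using g by (simp add: log_relation_def)
    ultimately show "g \<in> (\<Union>(B, m)\<in>C. log_relation B m)" by blast
  next
    fix g :: "real^'n^'n" assume "g \<in> (\<Union>(B, m)\<in>C. log_relation B m)"
    then obtain B m z where B: "finite B" "B \<subseteq> integer_vectors" "nonparallel B" "z \<in> B" "m z \<noteq> 0"
      and g: "g \<in> SL" and sum: "(\<Sum>z\<in>B. real_of_int (m z) * ln (norm (z v* g))) = 0"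
      by (auto simp: C_def log_relation_def)
    note inj = inj_vector_matrix_mult_SL[OF g]
    define m' where "m' = (\<lambda>v. m (inv (\<lambda>z. z v* g) v))"
    have m': "m' (z v* g) = m z" for z using inv_f_f[OF inj, of z] by (simp add: m'_def)
    have "(\<Sum>v\<in>(\<lambda>z. z v* g) ` B. real_of_int (m' v) * ln (norm v)) = 0"
      using sum by (subst sum.reindex) (auto simp: m' intro: inj_on_subset[OF inj])
    moreover have "m' (z v* g) \<noteq> 0" using B m' by simp
    ultimately have "\<not> log_independent (lattice_of g)"
      unfolding log_independent_def not_all not_imp
      using B nonparallel_image_iff[OF g, of B]
      by (intro exI[of _ "(\<lambda>z. z v* g) ` B"] exI[of _ m'] conjI)
        (auto simp: lattice_of_eq_image)
    with g show "g \<in> {g \<in> SL. \<not> log_independent (lattice_of g)}" by simp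
  qed
  also have "\<dots> \<in> null_sets H"
  proof (rule null_sets_UN')
    have "countable {B. finite B \<and> B \<subseteq> (integer_vectors :: (real^'n) set)}"
      using countable_Collect_finite_subset[OF countable_integer_vectors] by (simp add: conj_commute)
    then have "countable {B. finite B \<and> B \<subseteq> integer_vectors \<and> nonparallel (B :: (real^'n) set)}"
      by (rule countable_subset[rotated]) auto
    then show "countable C"
      unfolding C_def
    proof (rule countable_SIGMA)
      fix B :: "(real^'n) set" assume "B \<in> {B. finite B \<and> B \<subseteq> integer_vectors \<and> nonparallel B}"
      then have "countable (B \<rightarrow>\<^sub>E (UNIV :: int set))" by (intro countable_PiE) auto
      then show "countable {m \<in> B \<rightarrow>\<^sub>E (UNIV :: int set). \<exists>z\<in>B. m z \<noteq> 0}"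
        by (rule countable_subset[rotated]) blast
    qed
    show "(case x of (B, m) \<Rightarrow> log_relation B m) \<in> null_sets H" if "x \<in> C" for x
      using that null_sets_log_relation[OF H card] by (auto simp: C_def)
  qed
  finally show ?thesis .
qed

text \<open>The counting formula dominates the indicator of a measurable set of lattices, so \<open>\<mu>\<close> is
  absolutely continuous with respect to Haar measure and no fundamental domain is needed.\<close>
lemma AE_siegel_measure_log_independent:
  fixes \<mu> :: "(real^'n) set measure"
  assumes \<mu>: "siegel_measure \<mu>" and card: "CARD('n) \<ge> 2"
  shows "AE L in \<mu>. L \<in> unimodular_lattices \<and> log_independent L"
proof -
  obtain H where H: "haar_measure_SL H"
    and count: "\<And>B. B \<in> sets H \<Longrightarrow> emeasure H B =
           (\<integral>\<^sup>+ L. emeasure (count_space UNIV) {g \<in> B. lattice_of g = L} \<partial>\<mu>)"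
    using \<mu> by (auto simp: siegel_measure_def)
  have sets\<mu>: "A \<in> sets \<mu> \<longleftrightarrow> A \<subseteq> unimodular_lattices \<and> {g \<in> SL. lattice_of g \<in> A} \<in> sets H" for A
    using \<mu> H by (auto simp: siegel_measure_def haar_measure_SL_def)
  define Bad :: "(real^'n) set set" where "Bad = {L \<in> unimodular_lattices. \<not> log_independent L}"
  define P where "P = {g \<in> SL. lattice_of g \<in> Bad}"
  have P_eq: "P = {g \<in> SL. \<not> log_independent (lattice_of g)}"
    by (auto simp: P_def Bad_def unimodular_lattices_def)
  have P: "P \<in> null_sets H"
    unfolding P_eq by (rule null_sets_not_log_independent[OF H card])
  have Bad: "Bad \<in> sets \<mu>" unfolding sets\<mu> using P by (auto simp: Bad_def P_def)
  have "emeasure \<mu> Bad = (\<integral>\<^sup>+ L. indicator Bad L \<partial>\<mu>)" using Bad by simp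
  also have "\<dots> \<le> (\<integral>\<^sup>+ L. emeasure (count_space UNIV) {g \<in> P. lattice_of g = L} \<partial>\<mu>)"
  proof (intro nn_integral_mono)
    fix L :: "(real^'n) set"
    show "indicator Bad L \<le> emeasure (count_space UNIV) {g \<in> P. lattice_of g = L}"
    proof (cases "L \<in> Bad")
      case True
      then obtain g where "g \<in> SL" "lattice_of g = L"
        by (auto simp: Bad_def unimodular_lattices_def)
      then have "{g} \<subseteq> {g \<in> P. lattice_of g = L}" using True by (auto simp: P_def)
      then have "emeasure (count_space UNIV) {g} \<le> emeasure (count_space UNIV) {g \<in> P. lattice_of g = L}"
        by (intro emeasure_mono) auto
      then show ?thesis using True by (simp add: one_ennreal_def)
    qed simp
  qed
  also have "\<dots> = emeasure H P" using P count by auto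
  also have "\<dots> = 0" using P by auto
  finally have "Bad \<in> null_sets \<mu>" using Bad by auto
  moreover have "space \<mu> \<subseteq> unimodular_lattices" using sets\<mu>[of "space \<mu>"] by simp
  then have "{L \<in> space \<mu>. \<not> (L \<in> unimodular_lattices \<and> log_independent L)} \<subseteq> Bad"
    by (auto simp: Bad_def)
  ultimately show ?thesis by (rule AE_I')
qed

section \<open>Dirichlet series with independent frequencies\<close>

text \<open>Abstracts the series over the primitive vectors other than the shortest ones; the
  application has \<open>c = 2\<close> and \<open>\<alpha> = n\<close>. Independence is imposed on
  the set of logarithms and not on the indexed family, because \<open>p\<close> and
  \<open>- p\<close> share the same \<open>lam\<close>.\<close>

locale log_independent_series =
  fixes I :: "'a set" and lam :: "'a \<Rightarrow> real" and c \<alpha> :: real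
  assumes lam: "\<And>p. p \<in> I \<Longrightarrow> lam p > 1"
    and c: "c > 0"
    and summable: "\<And>\<sigma>. \<sigma> > \<alpha> \<Longrightarrow> (\<lambda>p. lam p powr (- \<sigma>)) summable_on I"
    and exceeds: "\<exists>\<sigma>>\<alpha>. (\<Sum>\<^sub>\<infinity>p\<in>I. lam p powr (- \<sigma>)) > c"
    and independent: "module.independent (\<lambda>r. (*) (real_of_int r)) ((\<lambda>p. ln (lam p)) ` I)"
begin

section \<open>The series in its half plane of absolute convergence\<close>

definition R :: "real \<Rightarrow> real" where
  "R \<sigma> = (\<Sum>\<^sub>\<infinity>p\<in>I. lam p powr (- \<sigma>))"

definition Z :: "complex \<Rightarrow> complex" where
  "Z s = (\<Sum>\<^sub>\<infinity>p\<in>I. complex_of_real (lam p) powr (- s))"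

lemma norm_term: "p \<in> I \<Longrightarrow> norm (complex_of_real (lam p) powr (- s)) = lam p powr (- Re s)"
  using lam[of p] by (simp add: norm_powr_real_powr)

lemma term_antimono: "p \<in> I \<Longrightarrow> \<beta> \<le> \<sigma> \<Longrightarrow> lam p powr (- \<sigma>) \<le> lam p powr (- \<beta>)"
  using lam[of p] by (intro powr_mono) auto

lemma abs_summable: "Re s > \<alpha> \<Longrightarrow> (\<lambda>p. norm (complex_of_real (lam p) powr (- s))) summable_on I"
  using summable[of "Re s"] by (subst summable_on_cong[OF norm_term]) auto

lemma summable_complex: "Re s > \<alpha> \<Longrightarrow> (\<lambda>p. complex_of_real (lam p) powr (- s)) summable_on I"
  using abs_summable by (rule abs_summable_summable)

lemma norm_Z_le: 
  assumes "Re s > \<alpha>"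
  shows "norm (Z s) \<le> R (Re s)"
proof -
  have "norm (Z s) \<le> (\<Sum>\<^sub>\<infinity>p\<in>I. norm (complex_of_real (lam p) powr (- s)))"
    unfolding Z_def by (rule norm_infsum_bound[OF abs_summable[OF assms]])
  also have "\<dots> = R (Re s)" unfolding R_def by (intro infsum_cong norm_term)
  finally show ?thesis .
qed

lemma Z_of_real:
  assumes "\<sigma> > \<alpha>"
  shows "Z (of_real \<sigma>) = of_real (R \<sigma>)"
proof -
  have "((\<lambda>p. complex_of_real (lam p powr (- \<sigma>))) has_sum of_real (R \<sigma>)) I"
    unfolding R_def by (intro has_sum_of_real has_sum_infsum summable assms)
  then have "(\<Sum>\<^sub>\<infinity>p\<in>I. complex_of_real (lam p powr (- \<sigma>))) = of_real (R \<sigma>)"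
    by (rule infsumI)
  moreover have "complex_of_real (lam p powr (- \<sigma>)) = of_real (lam p) powr (- of_real \<sigma>)" if "p \<in> I" for p
    using lam[OF that] powr_of_real[of "lam p" "- \<sigma>"] by simp
  ultimately show ?thesis by (simp add: Z_def cong: infsum_cong)
qed

lemma nonempty: "I \<noteq> {}"
  using exceeds c by auto

lemma R_strict_antimono:
  assumes "\<alpha> < \<sigma>" "\<sigma> < \<tau>"
  shows "R \<tau> < R \<sigma>"
proof -
  obtain p where p: "p \<in> I" using nonempty by auto
  show ?thesis
  proof (rule has_sum_strict_mono)
    show "((\<lambda>p. lam p powr (- \<tau>)) has_sum R \<tau>) I" "((\<lambda>p. lam p powr (- \<sigma>)) has_sum R \<sigma>) I"
      unfolding R_def using assms by (auto intro!: has_sum_infsum summable)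
    show "lam p powr (- \<tau>) < lam p powr (- \<sigma>)"
      using assms lam[OF p] by (intro powr_less_mono) auto
  qed (use assms p term_antimono in auto)
qed

text \<open>On a disc whose radius \<open>r\<close> is half the distance from \<open>z\<close> to
  the boundary line, the terms are dominated by those of the real series at
  \<open>\<alpha> + r\<close>, and the Weierstrass test gives uniform convergence.\<close>

lemma holomorphic_Z: "Z holomorphic_on {s. Re s > \<alpha>}"
proof -
  have "Z holomorphic_on ball z ((Re z - \<alpha>) / 2)" if z: "Re z > \<alpha>" for z
  proof -
    define r where "r = (Re z - \<alpha>) / 2"
    have Re: "Re s \<ge> \<alpha> + r" if "s \<in> cball z r" for s
    proof -
      have "\<bar>Re (z - s)\<bar> \<le> r" using that abs_Re_le_cmod[of "z - s"] by (simp add: dist_norm)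
      then have "Re z - Re s \<le> r" by simp
      moreover have "Re z = \<alpha> + 2 * r" unfolding r_def by simp argo
      ultimately show ?thesis by linarith
    qed
    have ul: "uniform_limit (cball z r) (\<lambda>X s. \<Sum>p\<in>X. complex_of_real (lam p) powr (- s)) Z
            (finite_subsets_at_top I)"
      unfolding Z_def
    proof (rule Weierstrass_m_test_general)
      show "norm (complex_of_real (lam p) powr (- s)) \<le> lam p powr (- (\<alpha> + r))"
        if "p \<in> I" "s \<in> cball z r" for p s
        using that Re by (simp only: norm_term term_antimono)
      show "(\<lambda>p. lam p powr (- (\<alpha> + r))) summable_on I" using z by (intro summable) (simp add: r_def)
    qed
    have hol: "(\<lambda>s. \<Sum>p\<in>X. complex_of_real (lam p) powr (- s)) holomorphic_on UNIV" if "X \<subseteq> I" for X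
      by (intro holomorphic_intros)
    have "\<forall>\<^sub>F X in finite_subsets_at_top I. X \<subseteq> I"
      by (simp add: eventually_finite_subsets_at_top_weakI)
    then have "\<forall>\<^sub>F X in finite_subsets_at_top I.
        continuous_on (cball z r) (\<lambda>s. \<Sum>p\<in>X. complex_of_real (lam p) powr (- s)) \<and>
        (\<lambda>s. \<Sum>p\<in>X. complex_of_real (lam p) powr (- s)) holomorphic_on ball z r"
      by (rule eventually_mono)
        (auto intro: holomorphic_on_imp_continuous_on[OF holomorphic_on_subset[OF hol]]
          holomorphic_on_subset[OF hol])
    from holomorphic_uniform_limit[OF this ul] show ?thesis by (auto simp: r_def)
  qed
  then have "Z holomorphic_on (\<Union>z\<in>{z. Re z > \<alpha>}. ball z ((Re z - \<alpha>) / 2))"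
    by (intro holomorphic_on_UN_open) auto
  then show ?thesis by (rule holomorphic_on_subset) auto
qed

section \<open>Size of the series on the real axis\<close>

lemma tail_small:
  assumes "\<beta> > \<alpha>" "\<epsilon> > 0"
  obtains A where "finite A" "A \<subseteq> I" "(\<Sum>\<^sub>\<infinity>p\<in>I - A. lam p powr (- \<beta>)) < \<epsilon>"
proof -
  let ?f = "\<lambda>p. lam p powr (- \<beta>)"
  have sum: "?f summable_on I" by (rule summable[OF assms(1)])
  then have "((\<lambda>p. ?f p) has_sum R \<beta>) I" unfolding R_def by (rule has_sum_infsum)
  then obtain A where A: "finite A" "A \<subseteq> I" "dist (sum ?f A) (R \<beta>) \<le> \<epsilon> / 2"
    using has_sum_finite_approximation[of ?f I "R \<beta>" "\<epsilon> / 2"] assms(2) by auto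
  have "(\<Sum>\<^sub>\<infinity>p\<in>I - A. ?f p) = R \<beta> - sum ?f A"
    unfolding R_def using A sum by (subst infsum_Diff) auto
  also have "\<dots> \<le> \<epsilon> / 2" using A(3) unfolding dist_real_def by argo
  also have "\<dots> < \<epsilon>" using assms(2) by simp
  finally show ?thesis using A(1,2) that by blast
qed

text \<open>A tail that is small at \<open>b\<close> stays small to the right of \<open>b\<close>,
  and the finitely many remaining terms tend to zero since \<open>lam p > 1\<close>.\<close>

lemma R_small: "\<exists>\<tau>>\<beta>. R \<tau> < c"
proof -
  define b where "b = max \<beta> \<alpha> + 1"
  have b: "b > \<alpha>" "b > \<beta>" by (auto simp: b_def)
  obtain A where A: "finite A" "A \<subseteq> I" "(\<Sum>\<^sub>\<infinity>p\<in>I - A. lam p powr (- b)) < c / 2"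
    using tail_small[OF b(1), of "c / 2"] c by auto
  have "((\<lambda>\<tau>. \<Sum>p\<in>A. lam p powr (- \<tau>)) \<longlongrightarrow> 0) at_top"
  proof (rule tendsto_null_sum)
    fix p assume "p \<in> A"
    then have "lam p > 1" using A lam by auto
    then show "((\<lambda>\<tau>. lam p powr (- \<tau>)) \<longlongrightarrow> 0) at_top" by real_asymp
  qed
  then have "\<forall>\<^sub>F \<tau> in at_top. (\<Sum>p\<in>A. lam p powr (- \<tau>)) < c / 2"
    by (rule order_tendstoD) (use c in simp)
  then have "\<forall>\<^sub>F \<tau> in at_top. \<tau> \<ge> b \<and> (\<Sum>p\<in>A. lam p powr (- \<tau>)) < c / 2"
    using eventually_ge_at_top[of b] by (simp add: eventually_conj_iff)
  then obtain \<tau> where \<tau>: "\<tau> \<ge> b" "(\<Sum>p\<in>A. lam p powr (- \<tau>)) < c / 2"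
    using eventually_happens'[OF trivial_limit_at_top_linorder] by blast
  have sums: "(\<lambda>p. lam p powr (- x)) summable_on (I - A)" if "x \<ge> b" for x
    by (rule summable_on_subset_banach[OF summable]) (use b that in auto)
  have "R \<tau> = (\<Sum>p\<in>A. lam p powr (- \<tau>)) + (\<Sum>\<^sub>\<infinity>p\<in>I - A. lam p powr (- \<tau>))"
    unfolding R_def using A summable[of \<tau>] b \<tau> by (subst infsum_Diff) auto
  also have "(\<Sum>\<^sub>\<infinity>p\<in>I - A. lam p powr (- \<tau>)) \<le> (\<Sum>\<^sub>\<infinity>p\<in>I - A. lam p powr (- b))"
    using \<tau> by (intro infsum_mono sums term_antimono) auto
  finally show ?thesis using A \<tau> b by (intro exI[of _ \<tau>]) auto
qed

lemma continuous_R: "continuous_on {\<alpha><..} R"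
proof -
  have "continuous_on {s. Re s > \<alpha>} Z" by (rule holomorphic_on_imp_continuous_on[OF holomorphic_Z])
  then have "continuous_on {\<alpha><..} (\<lambda>\<sigma>. Z (of_real \<sigma>))"
    by (rule continuous_on_compose2) (auto intro!: continuous_intros)
  then have "continuous_on {\<alpha><..} (\<lambda>\<sigma>. Re (Z (of_real \<sigma>)))"
    by (rule continuous_on_Re)
  then show ?thesis by (rule continuous_on_eq) (simp add: Z_of_real)
qed

lemma critical_exponent:
  obtains \<sigma>\<^sub>0 where "\<sigma>\<^sub>0 > \<alpha>" "R \<sigma>\<^sub>0 = c"
proof -
  obtain \<sigma> where \<sigma>: "\<sigma> > \<alpha>" "R \<sigma> > c" using exceeds by (auto simp: R_def)
  obtain \<tau> where \<tau>: "\<tau> > \<sigma>" "R \<tau> < c" using R_small by blast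
  have "continuous_on {\<sigma>..\<tau>} R" by (rule continuous_on_subset[OF continuous_R]) (use \<sigma> in auto)
  then obtain x where "\<sigma> \<le> x" "x \<le> \<tau>" "R x = c"
    using IVT2'[of R \<tau> c \<sigma>] \<sigma> \<tau> by auto
  then show ?thesis using that[of x] \<sigma> by simp
qed

section \<open>Kronecker approximation and the resulting zeros\<close>

text \<open>Kronecker's theorem brings all \<open>t0 * ln (lam p)\<close> close to
  \<open>1 / 2\<close> modulo one, but does not control the size of \<open>t0\<close>. Adding a
  large common near-period, supplied by Dirichlet's simultaneous approximation, moves the parameter
  beyond \<open>T\<close>.\<close>

lemma simultaneous_approximation:
  assumes A: "finite A" "A \<subseteq> I" and "\<epsilon> > 0"
  obtains t where "t > T" "\<And>p. p \<in> A \<Longrightarrow> norm (complex_of_real (lam p) powr (- (\<i> * of_real t)) + 1) \<le> \<epsilon>"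
proof -
  interpret M: Modules.module "\<lambda>r. (*) (real_of_int r)"
    by (simp add: Modules.module.intro distrib_left mult.commute)
  \<comment> \<open>Passing to the set of values merges indices with equal \<open>lam\<close>, so
    that the enumeration \<open>\<theta>\<close> is injective.\<close>
  define B where "B = (\<lambda>p. ln (lam p)) ` A"
  have "finite B" using A by (simp add: B_def)
  then obtain \<theta> :: "nat \<Rightarrow> real" where \<theta>: "bij_betw \<theta> {0..<card B} B"
    using ex_bij_betw_nat_finite by blast
  define n where "n = card B"
  have \<theta>B: "\<theta> ` {..<n} = B" "inj_on \<theta> {..<n}"
    using \<theta> by (auto simp: n_def bij_betw_def lessThan_atLeast0)
  have "M.independent B"
    by (rule M.independent_mono[OF independent]) (use A in \<open>auto simp: B_def\<close>)
  \<comment> \<open>The Kronecker and Dirichlet errors add up to at most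
    \<open>2 * \<delta>\<close>, and the final estimate \<open>2 * pi * (2 * \<delta>)\<close> then
    equals \<open>\<epsilon>\<close>.\<close>
  define \<delta> where "\<delta> = \<epsilon> / (4 * pi)"
  have \<delta>: "\<delta> > 0" using \<open>\<epsilon> > 0\<close> by (simp add: \<delta>_def)
  obtain t0 h where t0: "\<And>i. i < n \<Longrightarrow> \<bar>t0 * \<theta> i - of_int (h i) - 1 / 2\<bar> < \<delta>"
    using Kronecker_thm_1[of \<theta> n \<delta> "\<lambda>_. 1/2"] \<open>M.independent B\<close> \<theta>B \<delta> by metis
  \<comment> \<open>Every positive integer multiple of \<open>K\<close>, added to \<open>t0\<close>,
    is at least \<open>\<bar>T\<bar> + 1\<close>.\<close>
  define K where "K = \<bar>T\<bar> + \<bar>t0\<bar> + 1"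
  obtain N :: nat where N: "N > 0" "1 / real N < \<delta>"
    using \<delta> by (metis gr_zeroI inverse_eq_divide real_arch_inverse)
  obtain q p where q: "0 < q" and qp: "\<And>i. i < n \<Longrightarrow> \<bar>of_int q * (K * \<theta> i) - of_int (p i)\<bar> < 1 / N"
    using Dirichlet_approx_simult[OF N(1), of n "\<lambda>i. K * \<theta> i"] by metis
  define t where "t = 2 * pi * (t0 + of_int q * K)"
  have "of_int q * K \<ge> K" using q mult_right_mono[of 1 "real_of_int q" K] by (simp add: K_def)
  then have "t0 + of_int q * K \<ge> \<bar>T\<bar> + 1" by (simp add: K_def)
  then have "t \<ge> 1 * (\<bar>T\<bar> + 1)"
    unfolding t_def using pi_ge_two by (intro mult_mono) auto
  then have "t > T" by simp
  moreover have "norm (complex_of_real (lam x) powr (- (\<i> * of_real t)) + 1) \<le> \<epsilon>" if x: "x \<in> A" for x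
  proof -
    have "ln (lam x) \<in> \<theta> ` {..<n}" using x by (simp add: \<theta>B B_def)
    then obtain i where i: "i < n" "\<theta> i = ln (lam x)" by auto
    define d where "d = t0 * \<theta> i + of_int q * K * \<theta> i - of_int (h i + p i) - 1 / 2"
    have d: "\<bar>d\<bar> \<le> 2 * \<delta>" using t0[OF i(1)] qp[OF i(1)] N(2) unfolding d_def
      by (simp add: algebra_simps)
    have "t * ln (lam x) = 2 * pi * (d + of_int (h i + p i) + 1 / 2)"
      unfolding d_def t_def i(2)[symmetric] by (simp add: algebra_simps)
    then have t_ln: "t * ln (lam x) = 2 * pi * d + (2 * of_int (h i + p i) * pi + pi)"
      by (simp add: algebra_simps)
    have "lam x > 1" using x A lam by auto
    then have "complex_of_real (lam x) powr (- (\<i> * of_real t)) = cis (- (t * ln (lam x)))"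
      by (simp add: powr_def cis_conv_exp Ln_of_real mult_ac)
    also have "\<dots> = cis (- (2 * pi * d)) * cis (- (2 * of_int (h i + p i) * pi + pi))"
      unfolding t_ln by (simp add: cis_mult)
    also have "cis (- (2 * of_int (h i + p i) * pi + pi)) = cis (2 * pi * of_int (- (h i + p i))) * cis (- pi)"
      by (subst cis_mult) (simp add: algebra_simps)
    also have "\<dots> = - 1" by (subst cis_multiple_2pi) (auto simp: complex_eq_iff)
    finally have "complex_of_real (lam x) powr (- (\<i> * of_real t)) + 1 = - (exp (\<i> * of_real (- (2 * pi * d))) - 1)"
      by (simp add: cis_conv_exp)
    then have "norm (complex_of_real (lam x) powr (- (\<i> * of_real t)) + 1)
        = norm (exp (\<i> * of_real (- (2 * pi * d))) - 1)"
      by (simp only: norm_minus_cancel)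
    also have "\<dots> = 2 * \<bar>sin (- (2 * pi * d) / 2)\<bar>" by (rule dist_exp_i_1)
    also have "\<dots> \<le> 2 * \<bar>- (2 * pi * d) / 2\<bar>" by (intro mult_left_mono abs_sin_x_le_abs_x) auto
    also have "\<dots> = 2 * pi * \<bar>d\<bar>" by (simp add: abs_mult)
    also have "\<dots> \<le> 2 * pi * (2 * \<delta>)" using d by (intro mult_left_mono) auto
    also have "\<dots> = \<epsilon>" by (simp add: \<delta>_def)
    finally show ?thesis .
  qed
  ultimately show ?thesis using that by blast
qed

text \<open>On a finite head of the series each term is nearly negated by the translation; the tail
  is small in both series. All bounds are by the terms at \<open>\<beta>\<close>, hence uniform in
  the half plane.\<close>

lemma translate_approximation:
  assumes \<beta>: "\<beta> > \<alpha>" and "\<epsilon> > 0"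
  obtains t where "t > T" "\<And>s. Re s \<ge> \<beta> \<Longrightarrow> norm (Z (s + \<i> * of_real t) + Z s) \<le> \<epsilon>"
proof -
  obtain A where A: "finite A" "A \<subseteq> I" "(\<Sum>\<^sub>\<infinity>p\<in>I - A. lam p powr (- \<beta>)) < \<epsilon> / 4"
    using tail_small[OF \<beta>, of "\<epsilon> / 4"] \<open>\<epsilon> > 0\<close> by auto
  define Q where "Q = (\<Sum>p\<in>A. lam p powr (- \<beta>))"
  have Q: "Q \<ge> 0" by (auto simp: Q_def intro!: sum_nonneg)
  \<comment> \<open>The head costs at most \<open>Q * \<eta> \<le> \<epsilon> / 2\<close> and the
    tail at most twice \<open>\<epsilon> / 4\<close>; \<open>Q + 1\<close> keeps the denominator
    positive.\<close>
  define \<eta> where "\<eta> = \<epsilon> / (2 * (Q + 1))"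
  have \<eta>: "\<eta> > 0" using Q \<open>\<epsilon> > 0\<close> by (simp add: \<eta>_def)
  obtain t where t: "t > T" "\<And>p. p \<in> A \<Longrightarrow> norm (complex_of_real (lam p) powr (- (\<i> * of_real t)) + 1) \<le> \<eta>"
    using simultaneous_approximation[OF A(1,2) \<eta>] by blast
  have "norm (Z (s + \<i> * of_real t) + Z s) \<le> \<epsilon>" if s: "Re s \<ge> \<beta>" for s
  proof -
    define f where "f = (\<lambda>p. complex_of_real (lam p) powr (- (s + \<i> * of_real t)) + complex_of_real (lam p) powr (- s))"
    have fsum: "f summable_on I"
      unfolding f_def using s \<beta> by (intro summable_on_add summable_complex) auto
    have f_eq: "f p = complex_of_real (lam p) powr (- s) * (complex_of_real (lam p) powr (- (\<i> * of_real t)) + 1)" for p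
      by (simp add: f_def distrib_left powr_diff powr_minus powr_add field_simps)
    have fA: "norm (f p) \<le> lam p powr (- \<beta>) * \<eta>" if "p \<in> A" for p
      unfolding f_eq norm_mult using t(2)[OF that] s term_antimono[of p] that A
      by (intro mult_mono) (auto simp: norm_term)
    have fI: "norm (f p) \<le> 2 * lam p powr (- \<beta>)" if "p \<in> I" for p
    proof -
      have "norm (f p) \<le> lam p powr (- Re s) + lam p powr (- Re s)"
        unfolding f_def by (rule norm_triangle_le) (simp only: norm_term[OF that], simp)
      then show ?thesis using term_antimono[OF that s] by simp
    qed
    have sb: "(\<lambda>p. 2 * lam p powr (- \<beta>)) summable_on (I - A)"
      using summable_on_subset_banach[OF summable[OF \<beta>], of "I - A"] by (intro summable_on_cmult_right) auto
    have fabs: "(\<lambda>p. norm (f p)) summable_on (I - A)"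
      by (rule summable_on_comparison_test[OF sb]) (use fI in auto)
    have "Z (s + \<i> * of_real t) + Z s = infsum f I"
      unfolding Z_def f_def
      by (rule infsum_add[symmetric]; rule summable_complex) (use s \<beta> in auto)
    also have "\<dots> = sum f A + infsum f (I - A)"
      using fsum A by (subst infsum_Diff) auto
    also have "norm \<dots> \<le> norm (sum f A) + norm (infsum f (I - A))" by (rule norm_triangle_ineq)
    also have "norm (sum f A) \<le> (\<Sum>p\<in>A. lam p powr (- \<beta>) * \<eta>)" by (rule sum_norm_le[OF fA])
    also have "\<dots> = Q * \<eta>" by (simp add: Q_def sum_distrib_right)
    also have "\<dots> \<le> \<epsilon> / 2" using Q \<open>\<epsilon> > 0\<close> by (simp add: \<eta>_def field_simps)
    also have "norm (infsum f (I - A)) \<le> (\<Sum>\<^sub>\<infinity>p\<in>I - A. norm (f p))" by (rule norm_infsum_bound[OF fabs])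
    also have "\<dots> \<le> (\<Sum>\<^sub>\<infinity>p\<in>I - A. 2 * lam p powr (- \<beta>))"
      by (rule infsum_mono[OF fabs sb]) (use fI in auto)
    also have "\<dots> = 2 * (\<Sum>\<^sub>\<infinity>p\<in>I - A. lam p powr (- \<beta>))" by (rule infsum_cmult_right')
    finally show ?thesis using A(3) by simp
  qed
  then show ?thesis using that t(1) by blast
qed

lemma zero_Re_le:
  assumes "\<sigma>\<^sub>0 > \<alpha>" "R \<sigma>\<^sub>0 = c" "Re s > \<alpha>" "c + Z s = 0"
  shows "Re s \<le> \<sigma>\<^sub>0"
proof (rule ccontr)
  assume "\<not> Re s \<le> \<sigma>\<^sub>0"
  then have "R (Re s) < c" using R_strict_antimono[of \<sigma>\<^sub>0 "Re s"] assms by simp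
  moreover have "Z s = - of_real c" using assms(4) by (simp add: eq_neg_iff_add_eq_0 add.commute)
  then have "norm (Z s) = c" using c by simp
  ultimately show False using norm_Z_le[OF assms(3)] by simp
qed

text \<open>By Kronecker's theorem suitable vertical translates of \<open>Z\<close> converge to \<open>- Z\<close>, and \<open>c - Z\<close>
  vanishes at \<open>\<sigma>\<^sub>0\<close>.\<close>
lemma zeros_near:
  assumes \<sigma>\<^sub>0: "\<sigma>\<^sub>0 > \<alpha>" "R \<sigma>\<^sub>0 = c" and "\<epsilon> > 0"
  shows "\<exists>s. Re s > \<alpha> \<and> Re s > \<sigma>\<^sub>0 - \<epsilon> \<and> Im s > T \<and> c + Z s = 0"
proof -
  define r where "r = min \<epsilon> ((\<sigma>\<^sub>0 - \<alpha>) / 2)"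
  have r: "r > 0" "r \<le> \<epsilon>" "\<sigma>\<^sub>0 - r > \<alpha>" using \<sigma>\<^sub>0 \<open>\<epsilon> > 0\<close> by (auto simp: r_def min_def field_simps)
  let ?S = "ball (complex_of_real \<sigma>\<^sub>0) r"
  have Re_S: "Re s > \<sigma>\<^sub>0 - r" and Im_S: "Im s > - r" if "s \<in> ?S" for s
  proof -
    have "\<bar>Re (\<sigma>\<^sub>0 - s)\<bar> < r" "\<bar>Im (\<sigma>\<^sub>0 - s)\<bar> < r"
      using that abs_Re_le_cmod[of "\<sigma>\<^sub>0 - s"] abs_Im_le_cmod[of "\<sigma>\<^sub>0 - s"] by (simp_all add: dist_norm)
    then show "Re s > \<sigma>\<^sub>0 - r" "Im s > - r" by auto
  qed
  \<comment> \<open>Points of the disc have imaginary part above \<open>- r\<close>, so a shift by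
    more than \<open>T + r\<close> lifts every zero found there above height
    \<open>T\<close>.\<close>
  have "\<forall>n. \<exists>t. t > T + r \<and> (\<forall>s. Re s \<ge> \<sigma>\<^sub>0 - r \<longrightarrow> norm (Z (s + \<i> * of_real t) + Z s) \<le> 1 / real (Suc n))"
    using translate_approximation[OF r(3)] by (metis of_nat_0_less_iff zero_less_Suc zero_less_divide_1_iff)
  then obtain t where t: "\<And>n. t n > T + r"
    "\<And>n s. Re s \<ge> \<sigma>\<^sub>0 - r \<Longrightarrow> norm (Z (s + \<i> * of_real (t n)) + Z s) \<le> 1 / real (Suc n)"
    by metis
  define f where "f = (\<lambda>n s. c + Z (s + \<i> * of_real (t n)))"
  define g where "g = (\<lambda>s. c - Z s)"
  have "\<exists>n. \<exists>s\<in>?S. f n s = 0"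
  proof (rule ccontr)
    assume none: "\<not> (\<exists>n. \<exists>s\<in>?S. f n s = 0)"
    have "g (of_real \<sigma>\<^sub>0) \<noteq> 0"
    proof (rule Hurwitz_no_zeros[of ?S f g])
      show "f n holomorphic_on ?S" for n
        unfolding f_def
        by (intro holomorphic_intros holomorphic_on_compose_gen[OF _ holomorphic_Z, unfolded o_def])
          (use Re_S r in force)
      show "g holomorphic_on ?S"
        unfolding g_def by (intro holomorphic_intros holomorphic_on_subset[OF holomorphic_Z])
          (use Re_S r in force)
      show "uniform_limit K f g sequentially" if "compact K" "K \<subseteq> ?S" for K
      proof (rule uniform_limitI)
        fix e :: real assume "e > 0"
        have "(\<lambda>n. 1 / real (Suc n)) \<longlonglongrightarrow> 0" by real_asymp
        then have "\<forall>\<^sub>F n in sequentially. 1 / real (Suc n) < e" by (rule order_tendstoD) fact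
        then show "\<forall>\<^sub>F n in sequentially. \<forall>x\<in>K. dist (f n x) (g x) < e"
        proof (rule eventually_mono, intro ballI)
          fix n x assume "1 / real (Suc n) < e" "x \<in> K"
          then have "x \<in> ?S" using that by auto
          then have "norm (Z (x + \<i> * of_real (t n)) + Z x) \<le> 1 / real (Suc n)"
            using Re_S by (intro t) force
          then show "dist (f n x) (g x) < e"
            using \<open>1 / real (Suc n) < e\<close> by (simp add: dist_norm f_def g_def)
        qed
      qed
      \<comment> \<open>A constant \<open>g\<close> would contradict the strict decrease of
        \<open>R\<close> on the real axis.\<close>
      show "\<not> g constant_on ?S"
      proof
        assume "g constant_on ?S"
        moreover have "complex_of_real \<sigma>\<^sub>0 \<in> ?S" "complex_of_real (\<sigma>\<^sub>0 + r / 2) \<in> ?S"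
          using r by (auto simp: dist_norm)
        ultimately have "g (of_real \<sigma>\<^sub>0) = g (of_real (\<sigma>\<^sub>0 + r / 2))"
          unfolding constant_on_def by metis
        then have "R \<sigma>\<^sub>0 = R (\<sigma>\<^sub>0 + r / 2)"
          unfolding g_def using \<sigma>\<^sub>0 r Z_of_real[of \<sigma>\<^sub>0] Z_of_real[of "\<sigma>\<^sub>0 + r / 2"] by simp
        then show False using R_strict_antimono[of \<sigma>\<^sub>0 "\<sigma>\<^sub>0 + r / 2"] \<sigma>\<^sub>0 r by simp
      qed
    qed (use none r in auto)
    then show False using \<sigma>\<^sub>0 by (simp add: g_def Z_of_real)
  qed
  then obtain n s where "s \<in> ?S" "f n s = 0" by auto
  then show ?thesis
    using Re_S[of s] Im_S[of s] t(1)[of n] r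
    by (intro exI[of _ "s + \<i> * of_real (t n)"]) (auto simp: f_def)
qed

end

section \<open>The zeta function and integer vectors\<close>

lemma riemann_zeta_has_sum:
  assumes "Re s > 1"
  shows "((\<lambda>k. complex_of_nat (Suc k) powr (- s)) has_sum riemann_zeta s) UNIV"
proof (rule norm_summable_imp_has_sum)
  have "summable (\<lambda>k. real k powr (- Re s))"
    using assms by (simp add: summable_real_powr_iff)
  then have "summable (\<lambda>k. real (Suc k) powr (- Re s))"
    by (subst summable_Suc_iff)
  moreover have "norm (complex_of_nat (Suc k) powr (- s)) = real (Suc k) powr (- Re s)" for k
    using norm_powr_real_powr[of "complex_of_nat (Suc k)" "- s"] by (simp del: of_nat_Suc)
  ultimately show *: "summable (\<lambda>k. norm (complex_of_nat (Suc k) powr (- s)))" by simp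
  have "riemann_zeta s = (\<Sum>k. complex_of_nat (Suc k) powr (- s))"
    using assms by (simp add: riemann_zeta_def meromorphic_extension_def powr_minus_divide)
  then show "(\<lambda>k. complex_of_nat (Suc k) powr (- s)) sums riemann_zeta s"
    using summable_norm_cancel[OF *] by (simp add: summable_sums)
qed

text \<open>Gives nonvanishing and boundedness at once. The argument \<open>2 * s\<close> of the
  Epstein setting has real part above \<open>n\<close>, hence above 2.\<close>

lemma riemann_zeta_near_1:
  assumes "Re s \<ge> 2"
  shows "norm (riemann_zeta s - 1) \<le> 3 / 4"
proof -
  define f where "f = (\<lambda>k. complex_of_nat (Suc k) powr (- s))"
  \<comment> \<open>The bound \<open>1 / j^2 \<le> 1 / (j - 1) - 1 / j\<close> for
    \<open>j \<ge> 2\<close> telescopes to 1, too weak to exclude a zero. Using the exact value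
    \<open>1 / 4\<close> at \<open>j = 2\<close>, which is index \<open>k = 0\<close>, lowers the
    total to \<open>3 / 4\<close>.\<close>
  define h where "h = (\<lambda>k. (1 / real (Suc k) - 1 / real (Suc (Suc k))) - (if k = 0 then 1 / 4 else 0))"
  have "f sums riemann_zeta s"
    unfolding f_def using riemann_zeta_has_sum[of s] assms by (intro has_sum_imp_sums) auto
  then have fs: "(\<lambda>k. f (Suc k)) sums (riemann_zeta s - 1)"
    by (subst sums_Suc_iff) (simp add: f_def)
  have "(\<lambda>k. 1 / real (Suc k)) \<longlonglongrightarrow> 0"
    using LIMSEQ_inverse_real_of_nat by (simp add: inverse_eq_divide)
  then have "(\<lambda>k. 1 / real (Suc k) - 1 / real (Suc (Suc k))) sums (1 / real (Suc 0) - 0)"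
    by (rule telescope_sums')
  then have "h sums (1 - 1 / 4)" unfolding h_def
    using sums_single[of 0 "\<lambda>_. 1 / 4 :: real"] by (intro sums_diff) auto
  then have hs: "h sums (3 / 4)" by simp
  have fh: "norm (f (Suc k)) \<le> h k" for k
  proof -
    have "norm (f (Suc k)) = real (Suc (Suc k)) powr (- Re s)"
      unfolding f_def using norm_powr_real_powr[of "complex_of_nat (Suc (Suc k))" "- s"]
      by (simp del: of_nat_Suc)
    also have "\<dots> \<le> real (Suc (Suc k)) powr (- 2)" using assms by (intro powr_mono) auto
    also have "\<dots> = 1 / (real (Suc (Suc k)))\<^sup>2"
      by (simp add: powr_minus_divide powr_numeral del: of_nat_Suc)
    also have "\<dots> \<le> h k"
    proof (cases "k = 0")
      case False
      have "h k = 1 / (real (Suc k) * real (Suc (Suc k)))"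
        using False by (simp add: h_def divide_simps)
      moreover have "real (Suc k) * real (Suc (Suc k)) \<le> (real (Suc (Suc k)))\<^sup>2"
        unfolding power2_eq_square by (intro mult_right_mono) auto
      ultimately show ?thesis by (simp add: divide_left_mono del: of_nat_Suc)
    qed (simp add: h_def power2_eq_square)
    finally show ?thesis .
  qed
  have "norm (\<Sum>k. f (Suc k)) \<le> (\<Sum>k. h k)"
    by (rule norm_suminf_le[OF fh]) (use hs in \<open>auto simp: sums_iff\<close>)
  then show ?thesis using fs hs by (simp add: sums_iff)
qed

lemma riemann_zeta_nonzero: "Re s \<ge> 2 \<Longrightarrow> riemann_zeta s \<noteq> 0"
  using riemann_zeta_near_1[of s] by auto

lemma norm_riemann_zeta_le: "Re s \<ge> 2 \<Longrightarrow> norm (riemann_zeta s) \<le> 2"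
  using riemann_zeta_near_1[of s] norm_triangle_sub[of "riemann_zeta s" 1] by simp

section \<open>Primitive integer vectors\<close>

text \<open>Integer vectors are kept as integer-valued functions, where \<open>Gcd\<close> is
  available; \<open>int_vec\<close> carries them to real vectors.\<close>

definition nonzero_ints :: "('n \<Rightarrow> int) set" where
  "nonzero_ints = UNIV - {\<lambda>_. 0}"

definition primitive :: "('n \<Rightarrow> int) set" where
  "primitive = {z. Gcd (range z) = 1}"

definition int_vec :: "('n \<Rightarrow> int) \<Rightarrow> real^'n" where
  "int_vec z = (\<chi> i. real_of_int (z i))"

lemma primitive_nonzero: "primitive \<subseteq> nonzero_ints"
  by (auto simp: primitive_def nonzero_ints_def)

lemma uminus_primitive:
  assumes "p \<in> primitive"
  shows "(\<lambda>i. - p i) \<in> primitive"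
proof -
  have "range (\<lambda>i. - p i) = (*) (- 1) ` range p" by (simp add: image_image)
  then have "Gcd (range (\<lambda>i. - p i)) = Gcd (range p)" by (simp only: Gcd_mult) simp
  then show ?thesis using assms by (simp add: primitive_def)
qed

text \<open>The multiplier is the gcd of the entries: this gives uniqueness, and dividing by it
  gives existence. Only positive multipliers occur, so \<open>p\<close> and \<open>- p\<close> count
  as different primitive vectors.\<close>

lemma bij_betw_primitive_multiples:
  "bij_betw (\<lambda>(k, p) i. int (Suc k) * p i) (UNIV \<times> primitive) (nonzero_ints :: ('n \<Rightarrow> int) set)"
proof (rule bij_betwI')
  have Gcd: "Gcd (range (\<lambda>i. c * p i)) = \<bar>c\<bar> * Gcd (range p)" for c :: int and p :: "'n \<Rightarrow> int"
  proof -
    have "range (\<lambda>i. c * p i) = (*) c ` range p" by (simp add: image_image)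
    then show ?thesis by (simp only: Gcd_mult) (simp add: abs_mult)
  qed
  fix x y :: "nat \<times> ('n \<Rightarrow> int)"
  assume "x \<in> UNIV \<times> primitive" "y \<in> UNIV \<times> primitive"
  then obtain k p l q where x: "x = (k, p)" "y = (l, q)" and pq: "Gcd (range p) = 1" "Gcd (range q) = 1"
    by (auto simp: primitive_def)
  show "(case x of (k, p) \<Rightarrow> \<lambda>i. int (Suc k) * p i) = (case y of (k, p) \<Rightarrow> \<lambda>i. int (Suc k) * p i)
          \<longleftrightarrow> x = y"
  proof
    assume "(case x of (k, p) \<Rightarrow> \<lambda>i. int (Suc k) * p i) = (case y of (k, p) \<Rightarrow> \<lambda>i. int (Suc k) * p i)"
    then have eq: "(\<lambda>i. int (Suc k) * p i) = (\<lambda>i. int (Suc l) * q i)" by (simp add: x)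
    then have "k = l" using arg_cong[OF eq, of "\<lambda>f. Gcd (range f)"] unfolding Gcd pq by simp
    moreover from this have "p = q" using eq by (auto simp: fun_eq_iff simp del: of_nat_Suc)
    ultimately show "x = y" by (simp add: x)
  qed auto
next
  fix x :: "nat \<times> ('n \<Rightarrow> int)" assume "x \<in> UNIV \<times> primitive"
  then show "(case x of (k, p) \<Rightarrow> \<lambda>i. int (Suc k) * p i) \<in> nonzero_ints"
    using primitive_nonzero by (fastforce simp: nonzero_ints_def fun_eq_iff simp del: of_nat_Suc)
next
  fix z :: "'n \<Rightarrow> int" assume z: "z \<in> nonzero_ints"
  define d where "d = Gcd (range z)"
  have "d \<noteq> 0" using z by (auto simp: d_def nonzero_ints_def fun_eq_iff)
  moreover have "d \<ge> 0" by (simp add: d_def)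
  ultimately have "d > 0" by simp
  define p where "p = (\<lambda>i. z i div d)"
  have "d dvd z i" for i unfolding d_def by (intro Gcd_dvd) simp
  then have z_eq: "z = (\<lambda>i. d * p i)" by (simp add: p_def fun_eq_iff)
  have "range z = (*) d ` range p" by (subst z_eq) (simp add: image_image)
  then have "d = normalize (d * Gcd (range p))" using Gcd_mult[of d "range p"] by (simp add: d_def)
  then have "d * Gcd (range p) = d * 1" using \<open>d > 0\<close> by (simp add: abs_mult)
  then have "Gcd (range p) = 1" using \<open>d > 0\<close> by (simp only: mult_cancel_left) simp
  then have "(nat d - 1, p) \<in> UNIV \<times> primitive" by (simp add: primitive_def)
  moreover have "int (Suc (nat d - 1)) = d" using \<open>d > 0\<close> by simp
  then have "z = (case (nat d - 1, p) of (k, p) \<Rightarrow> \<lambda>i. int (Suc k) * p i)"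
    using z_eq by (simp del: of_nat_Suc)
  ultimately show "\<exists>x\<in>UNIV \<times> primitive. z = (case x of (k, p) \<Rightarrow> \<lambda>i. int (Suc k) * p i)" by blast
qed

text \<open>Proportionality gives \<open>q i * p j = p i * q j\<close> for all \<open>j\<close>;
  taking the gcd over \<open>j\<close> yields
  \<open>\<bar>q i\<bar> = \<bar>p i\<bar>\<close>.\<close>

lemma int_vec_parallel_primitive:
  assumes p: "p \<in> primitive" and q: "q \<in> primitive" and eq: "int_vec p = c *\<^sub>R int_vec q"
  shows "p = q \<or> p = (\<lambda>i. - q i)"
proof -
  have pq: "real_of_int (p i) = c * q i" for i
    using eq by (simp add: int_vec_def vec_eq_iff)
  obtain i where i: "q i \<noteq> 0"
    using q primitive_nonzero by (auto simp: nonzero_ints_def fun_eq_iff)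
  have cross: "q i * p j = p i * q j" for j
  proof -
    have "real_of_int (q i * p j) = real_of_int (p i * q j)" by (simp add: pq)
    then show ?thesis by (simp only: of_int_eq_iff)
  qed
  have "(*) (q i) ` range p = (*) (p i) ` range q"
    by (simp add: image_image cross)
  then have "normalize (q i * Gcd (range p)) = normalize (p i * Gcd (range q))"
    by (metis Gcd_mult)
  then have "\<bar>q i\<bar> = \<bar>p i\<bar>" using p q by (simp add: primitive_def)
  then consider "p i = q i" | "p i = - q i" by (auto simp: abs_if split: if_splits)
  then show ?thesis
  proof cases
    case 1
    then have "p = q" using cross i by (auto simp: fun_eq_iff)
    then show ?thesis ..
  next
    case 2
    then have "p j = - q j" for j using cross[of j] i by (metis mult_cancel_left mult_minus_left mult_minus_right)
    then show ?thesis by auto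
  qed
qed

section \<open>Convergence and divergence of sums over integer vectors\<close>

lemma norm_int_vec_ge: "\<bar>real_of_int (z i)\<bar> \<le> norm (int_vec z)"
  using component_le_norm_cart[of "int_vec z" i] by (simp add: int_vec_def)

lemma norm_int_vec_ge_1:
  assumes "z \<in> nonzero_ints"
  shows "norm (int_vec z) \<ge> 1"
proof -
  obtain i where "z i \<noteq> 0" using assms by (auto simp: nonzero_ints_def fun_eq_iff)
  then have "1 \<le> \<bar>real_of_int (z i)\<bar>" by linarith
  then show ?thesis using norm_int_vec_ge[of z i] by simp
qed

text \<open>The maximum with 1 makes the term at \<open>0\<close> equal to 1, where
  \<open>0 powr (- \<tau>)\<close> would be 0; products over coordinates then stay positive for
  vectors with zero entries.\<close>

lemma summable_max_powr_int:
  assumes "\<tau> > 1"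
  shows "(\<lambda>x::int. max 1 \<bar>real_of_int x\<bar> powr (- \<tau>)) summable_on UNIV"
proof -
  let ?f = "\<lambda>x::int. max 1 \<bar>real_of_int x\<bar> powr (- \<tau>)"
  have "summable (\<lambda>n. real n powr (- \<tau>))" using assms by (simp add: summable_real_powr_iff)
  then have "summable (\<lambda>n. max 1 (real n) powr (- \<tau>))"
    by (rule summable_cong[THEN iffD1, rotated]) (auto intro!: eventually_sequentiallyI[of 1])
  then have "(\<lambda>n. max 1 (real n) powr (- \<tau>)) summable_on UNIV"
    by (subst summable_on_UNIV_nonneg_real_iff) auto
  then have "?f summable_on range int" "?f summable_on range (\<lambda>n. - int n)"
    by (subst summable_on_reindex; simp add: inj_on_def o_def)+
  then have "?f summable_on (range int \<union> range (\<lambda>n. - int n))" by (rule summable_on_union)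
  moreover have "range int \<union> range (\<lambda>n. - int n) = UNIV"
    by (auto intro: int_cases2)
  ultimately show ?thesis by simp
qed

text \<open>The norm of \<open>z\<close> dominates the geometric mean of the \<open>max 1 \<bar>z\<^sub>i\<bar>\<close>, which bounds partial sums
  over \<open>\<int>\<^sup>n\<close> by the \<open>n\<close>-th power of a sum over \<open>\<int>\<close>.\<close>
lemma summable_norm_int_vec:
  assumes "\<sigma> > real CARD('n)"
  shows "(\<lambda>z :: 'n::finite \<Rightarrow> int. norm (int_vec z) powr (- \<sigma>)) summable_on nonzero_ints"
proof (rule nonneg_bdd_above_summable_on)
  define n where "n = CARD('n)"
  have n: "n > 0" by (simp add: n_def)
  \<comment> \<open>The exponent is shared equally among the coordinates;
    \<open>\<sigma> / n > 1\<close> makes the one-dimensional sum converge.\<close>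
  define h where "h = (\<lambda>x::int. max 1 \<bar>real_of_int x\<bar> powr (- (\<sigma> / n)))"
  have "h summable_on UNIV"
    unfolding h_def using assms n by (intro summable_max_powr_int) (simp add: n_def field_simps)
  define S where "S = infsum h UNIV"
  have le_h: "norm (int_vec z) powr (- \<sigma>) \<le> (\<Prod>i\<in>UNIV. h (z i))"
    if z: "z \<in> nonzero_ints" for z :: "'n \<Rightarrow> int"
  proof -
    have "norm (int_vec z) powr (- \<sigma>) = (norm (int_vec z) powr (- (\<sigma> / n))) ^ n"
      using n norm_int_vec_ge_1[OF z] by (subst powr_power) auto
    also have "\<dots> = (\<Prod>i\<in>(UNIV :: 'n set). norm (int_vec z) powr (- (\<sigma> / n)))" by (simp add: n_def)
    also have "\<dots> \<le> (\<Prod>i\<in>UNIV. h (z i))"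
      unfolding h_def using norm_int_vec_ge norm_int_vec_ge_1[OF z] assms n
      by (intro prod_mono conjI powr_mono2') (auto simp: n_def)
    finally show ?thesis .
  qed
  have "sum (\<lambda>z. norm (int_vec z) powr (- \<sigma>)) F \<le> S ^ n"
    if F: "F \<subseteq> nonzero_ints" "finite F" for F :: "('n \<Rightarrow> int) set"
  proof -
    \<comment> \<open>All coordinates of vectors in \<open>F\<close> lie in \<open>X\<close>, so
      \<open>F\<close> is contained in a finite box over which the sum of products factors.\<close>
    define X where "X = (\<Union>z\<in>F. range z)"
    have X: "finite X" using F by (simp add: X_def)
    have FX: "F \<subseteq> Pi\<^sub>E UNIV (\<lambda>_. X)" by (auto simp: X_def)
    have "sum (\<lambda>z. norm (int_vec z) powr (- \<sigma>)) F \<le> (\<Sum>z\<in>F. \<Prod>i\<in>UNIV. h (z i))"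
      using F by (intro sum_mono le_h) auto
    also have "\<dots> \<le> (\<Sum>z\<in>Pi\<^sub>E (UNIV :: 'n set) (\<lambda>_. X). \<Prod>i\<in>UNIV. h (z i))"
      using X FX by (intro sum_mono2 finite_PiE prod_nonneg) (auto simp: h_def)
    also have "\<dots> = (\<Prod>i\<in>(UNIV :: 'n set). \<Sum>x\<in>X. h x)"
      using X by (subst prod_sum_PiE) auto
    also have "\<dots> = (\<Sum>x\<in>X. h x) ^ n" by (simp add: n_def)
    also have "\<dots> \<le> S ^ n"
    proof (intro power_mono)
      show "sum h X \<le> S" unfolding S_def
        by (rule finite_sum_le_infsum) (use X \<open>h summable_on UNIV\<close> in \<open>auto simp: h_def\<close>)
    qed (auto simp: h_def intro!: sum_nonneg)
    finally show ?thesis .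
  qed
  then show "bdd_above (sum (\<lambda>z :: 'n \<Rightarrow> int. norm (int_vec z) powr (- \<sigma>)) ` {F. F \<subseteq> nonzero_ints \<and> finite F})"
    by (intro bdd_aboveI2[of _ _ "S ^ n"]) auto
qed simp

text \<open>Each dyadic box \<open>[2\<^sup>k, 2\<^sup>k\<^sup>+\<^sup>1)\<^sup>n\<close> contributes at least \<open>(2n)\<^sup>-\<^sup>n\<close>, independently of \<open>k\<close>.\<close>
lemma unbounded_sum_norm_int_vec:
  obtains F :: "('n::finite \<Rightarrow> int) set" where "finite F" "F \<subseteq> nonzero_ints"
    "(\<Sum>z\<in>F. norm (int_vec z) powr (- real CARD('n))) > K"
proof -
  define n where "n = CARD('n)"
  have n: "n > 0" by (simp add: n_def)
  define B :: "nat \<Rightarrow> ('n \<Rightarrow> int) set" where "B = (\<lambda>k. Pi\<^sub>E UNIV (\<lambda>_. {2 ^ k..<2 ^ Suc k}))"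
  have B_iff: "z \<in> B k \<longleftrightarrow> (\<forall>i. 2 ^ k \<le> z i \<and> z i < 2 ^ Suc k)" for z k
    by (auto simp: B_def PiE_def Pi_def)
  have fin: "finite (B k)" for k unfolding B_def by (intro finite_PiE) auto
  have card_B: "card (B k) = (2 ^ k) ^ n" for k
    unfolding B_def n_def by (subst card_PiE) (auto simp: nat_power_eq)
  have disj: "B k \<inter> B l = {}" if "k \<noteq> l" for k l
  proof (rule ccontr)
    assume "B k \<inter> B l \<noteq> {}"
    then obtain z where z: "z \<in> B k" "z \<in> B l" by auto
    obtain i :: 'n where True by simp
    have "(2::int) ^ k < 2 ^ Suc l" "(2::int) ^ l < 2 ^ Suc k"
      using z[unfolded B_iff, rule_format, of i] by linarith+
    then have "k < Suc l" "l < Suc k" by (simp_all only: power_strict_increasing_iff one_less_numeral_iff semiring_norm)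
    with that show False by simp
  qed
  \<comment> \<open>A box has \<open>2^(k n)\<close> points of norm at most
    \<open>n 2^(k + 1)\<close>; raised to the power \<open>- n\<close>, the factors depending on
    \<open>k\<close> cancel.\<close>
  define \<delta> where "\<delta> = (1 / (2 * real n)) ^ n"
  have "\<delta> > 0" using n by (simp add: \<delta>_def)
  have sumB: "(\<Sum>z\<in>B k. norm (int_vec z) powr (- real n)) \<ge> \<delta>" for k
  proof -
    have "norm (int_vec z) powr (- real n) \<ge> (1 / (real n * 2 ^ Suc k)) ^ n" if z: "z \<in> B k" for z
    proof -
      have "norm (int_vec z) \<le> (\<Sum>i\<in>UNIV. \<bar>int_vec z $ i\<bar>)" by (rule norm_le_l1_cart)
      also have "\<dots> \<le> (\<Sum>i\<in>(UNIV :: 'n set). 2 ^ Suc k)"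
      proof (rule sum_mono)
        fix i
        have "\<bar>z i\<bar> \<le> 2 ^ Suc k" using z[unfolded B_iff, rule_format, of i] zero_less_power[of "2::int" k] by linarith
        then have "real_of_int \<bar>z i\<bar> \<le> real_of_int (2 ^ Suc k)" by (simp only: of_int_le_iff)
        then show "\<bar>int_vec z $ i\<bar> \<le> 2 ^ Suc k" by (simp add: int_vec_def)
      qed
      also have "\<dots> = real n * 2 ^ Suc k" by (simp add: n_def)
      finally have le: "norm (int_vec z) \<le> real n * 2 ^ Suc k" .
      have "z \<in> nonzero_ints"
        using z[unfolded B_iff] zero_less_power[of "2::int" k] by (fastforce simp: nonzero_ints_def)
      then have "norm (int_vec z) \<ge> 1" by (rule norm_int_vec_ge_1)
      then have "norm (int_vec z) > 0" by linarith
      then have "norm (int_vec z) powr (- real n) = (1 / norm (int_vec z)) ^ n"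
        by (simp add: powr_minus_divide powr_realpow power_one_over)
      also have "\<dots> \<ge> (1 / (real n * 2 ^ Suc k)) ^ n"
        using le \<open>norm (int_vec z) > 0\<close> n by (intro power_mono divide_left_mono) auto
      finally show ?thesis .
    qed
    then have "(\<Sum>z\<in>B k. norm (int_vec z) powr (- real n)) \<ge> (\<Sum>z\<in>B k. (1 / (real n * 2 ^ Suc k)) ^ n)"
      by (rule sum_mono)
    also have "(\<Sum>z\<in>B k. (1 / (real n * 2 ^ Suc k)) ^ n) = (2 ^ k * (1 / (real n * 2 ^ Suc k))) ^ n"
      by (simp only: sum_constant card_B of_nat_power of_nat_numeral power_mult_distrib)
    also have "2 ^ k * (1 / (real n * 2 ^ Suc k)) = 1 / (2 * real n)" by simp
    finally show ?thesis by (simp add: \<delta>_def)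
  qed
  obtain M :: nat where M: "real M * \<delta> > K" using ex_less_of_nat_mult[OF \<open>\<delta> > 0\<close>] by blast
  define F where "F = (\<Union>k<M. B k)"
  have "(\<Sum>z\<in>F. norm (int_vec z) powr (- real n)) = (\<Sum>k<M. \<Sum>z\<in>B k. norm (int_vec z) powr (- real n))"
    unfolding F_def using fin disj by (intro sum.UNION_disjoint) auto
  also have "\<dots> \<ge> (\<Sum>k<M. \<delta>)" by (intro sum_mono sumB)
  finally have "(\<Sum>z\<in>F. norm (int_vec z) powr (- real n)) > K" using M by simp
  moreover have "F \<subseteq> nonzero_ints"
  proof
    fix z assume "z \<in> F"
    then obtain k where "z \<in> B k" by (auto simp: F_def)
    then show "z \<in> nonzero_ints"
      using zero_less_power[of "2::int" k] unfolding B_iff by (fastforce simp: nonzero_ints_def)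
  qed
  ultimately show ?thesis using that[of F] fin by (simp add: F_def n_def)
qed

section \<open>Generic lattices\<close>

text \<open>Collects what holds for almost every lattice; from here on the argument concerns a
  single lattice with a fixed basis, and no measure occurs.\<close>

locale generic_lattice =
  fixes g :: "real^'n^'n"
  assumes SL: "g \<in> SL" and card_ge_2: "CARD('n) \<ge> 2" and independent: "log_independent (lattice_of g)"
begin

section \<open>Lengths of lattice vectors\<close>

definition N :: "('n \<Rightarrow> int) \<Rightarrow> real" where
  "N z = norm (int_vec z v* g)"

lemma int_vec_eq_iff: "int_vec z = int_vec z' \<longleftrightarrow> z = z'"
  by (auto simp: int_vec_def vec_eq_iff fun_eq_iff)

lemma int_vec_mult: "int_vec (\<lambda>i. c * z i) = real_of_int c *\<^sub>R int_vec z"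
  by (simp add: int_vec_def vec_eq_iff)

lemma N_mult: "N (\<lambda>i. c * z i) = \<bar>real_of_int c\<bar> * N z"
  by (simp add: N_def int_vec_mult scaleR_vector_matrix_assoc)

lemma N_uminus: "N (\<lambda>i. - z i) = N z"
  using N_mult[of "- 1" z] by simp

lemma N_pos: "z \<in> nonzero_ints \<Longrightarrow> N z > 0"
  using vector_matrix_mult_SL_eq_0[OF SL, of "int_vec z"]
  by (auto simp: N_def nonzero_ints_def int_vec_def vec_eq_iff fun_eq_iff)

text \<open>An injective linear map of a finite-dimensional space distorts norms by bounded factors.
  This transfers convergence and divergence from integer vectors to the lattice.\<close>

lemma N_bounds:
  obtains a b where "a > 0" "b > 0" "\<And>z. a * norm (int_vec z) \<le> N z" "\<And>z. N z \<le> b * norm (int_vec z)"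
proof -
  have "linear (\<lambda>x. x v* g)"
    by (simp flip: transpose_matrix_vector)
  obtain a where a: "a > 0" "\<And>x. a * norm x \<le> norm (x v* g)"
    using linear_inj_bounded_below_pos[OF \<open>linear _\<close> inj_vector_matrix_mult_SL[OF SL]] by blast
  obtain b where b: "b > 0" "\<And>x. norm (x v* g) \<le> b * norm x"
    using linear_bounded_pos[OF \<open>linear _\<close>] by blast
  show ?thesis using that[OF a(1) b(1)] a(2) b(2) by (simp add: N_def)
qed

lemma inj_lattice: "inj (\<lambda>z. int_vec z v* g)"
  using injD[OF inj_vector_matrix_mult_SL[OF SL]] by (auto intro!: injI simp flip: int_vec_eq_iff)

lemma int_vec_in_lattice: "int_vec z v* g \<in> lattice_of g"
  by (auto simp: lattice_of_def int_vec_def)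

lemma lattice_minus_0: "lattice_of g - {0} = (\<lambda>z. int_vec z v* g) ` nonzero_ints"
proof (intro equalityI subsetI)
  fix v assume "v \<in> lattice_of g - {0}"
  then obtain x :: "real^'n" where x: "v = x v* g" "\<And>i. x $ i \<in> \<int>" "v \<noteq> 0" by (auto simp: lattice_of_def)
  define z where "z = (\<lambda>i. \<lfloor>x $ i\<rfloor>)"
  have "x = int_vec z" using x(2) by (simp add: z_def int_vec_def vec_eq_iff)
  moreover have "z \<in> nonzero_ints"
  proof (rule ccontr)
    assume "z \<notin> nonzero_ints"
    then have "x = 0" unfolding \<open>x = int_vec z\<close> by (simp add: nonzero_ints_def int_vec_def vec_eq_iff)
    then show False using x by simp
  qed
  ultimately show "v \<in> (\<lambda>z. int_vec z v* g) ` nonzero_ints" using x by blast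
next
  fix v assume "v \<in> (\<lambda>z. int_vec z v* g) ` nonzero_ints"
  then show "v \<in> lattice_of g - {0}" using int_vec_in_lattice N_pos by (force simp: N_def)
qed

lemma summable_N:
  assumes "\<sigma> > real CARD('n)"
  shows "(\<lambda>z. N z powr (- \<sigma>)) summable_on nonzero_ints"
proof -
  obtain a where a: "a > 0" "\<And>z. a * norm (int_vec z) \<le> N z" using N_bounds by metis
  have "(\<lambda>z :: 'n \<Rightarrow> int. a powr (- \<sigma>) * norm (int_vec z) powr (- \<sigma>)) summable_on nonzero_ints"
    by (intro summable_on_cmult_right summable_norm_int_vec assms)
  then show ?thesis
  proof (rule summable_on_comparison_test)
    fix z :: "'n \<Rightarrow> int" assume z: "z \<in> nonzero_ints"
    have "N z powr (- \<sigma>) \<le> (a * norm (int_vec z)) powr (- \<sigma>)"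
      using a assms norm_int_vec_ge_1[OF z] by (intro powr_mono2') (auto intro!: mult_pos_pos)
    then show "N z powr (- \<sigma>) \<le> a powr (- \<sigma>) * norm (int_vec z) powr (- \<sigma>)"
      using a by (simp add: powr_mult)
  qed simp
qed

lemma unbounded_sum_N:
  obtains F where "finite F" "F \<subseteq> nonzero_ints" "(\<Sum>z\<in>F. N z powr (- real CARD('n))) > K"
proof -
  define n where "n = real CARD('n)"
  obtain b where b: "b > 0" "\<And>z. N z \<le> b * norm (int_vec z)" using N_bounds by metis
  obtain F :: "('n \<Rightarrow> int) set" where F: "finite F" "F \<subseteq> nonzero_ints"
    "(\<Sum>z\<in>F. norm (int_vec z) powr (- n)) > K / b powr (- n)"
    unfolding n_def using unbounded_sum_norm_int_vec by blast
  have "K < b powr (- n) * (\<Sum>z\<in>F. norm (int_vec z) powr (- n))"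
    using F(3) b by (simp add: field_simps)
  also have "\<dots> = (\<Sum>z\<in>F. b powr (- n) * norm (int_vec z) powr (- n))"
    by (rule sum_distrib_left)
  also have "\<dots> \<le> (\<Sum>z\<in>F. N z powr (- n))"
  proof (rule sum_mono)
    fix z assume "z \<in> F"
    then have "N z > 0" using F N_pos by auto
    then have "(b * norm (int_vec z)) powr (- n) \<le> N z powr (- n)"
      using b by (intro powr_mono2') (auto simp: n_def)
    then show "b powr (- n) * norm (int_vec z) powr (- n) \<le> N z powr (- n)"
      using b by (simp add: powr_mult)
  qed
  finally show ?thesis using that[OF F(1,2)] by (simp add: n_def)
qed

lemma norm_N_powr: "z \<in> nonzero_ints \<Longrightarrow> norm (complex_of_real (N z) powr s) = N z powr Re s"
  using N_pos[of z] by (simp add: norm_powr_real_powr)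

lemma summable_complex_N:
  assumes "Re s > real CARD('n)"
  shows "(\<lambda>z. complex_of_real (N z) powr (- s)) summable_on nonzero_ints"
proof (rule abs_summable_summable)
  show "(\<lambda>z. norm (complex_of_real (N z) powr (- s))) summable_on nonzero_ints"
    using summable_N[OF assms] by (subst summable_on_cong[OF norm_N_powr]) auto
qed

section \<open>Primitive vectors and the normalized lengths\<close>

lemma zeta_factorization:
  assumes s: "Re s > real CARD('n)"
  shows "(\<Sum>\<^sub>\<infinity>z\<in>nonzero_ints. complex_of_real (N z) powr (- s)) =
    riemann_zeta s * (\<Sum>\<^sub>\<infinity>p\<in>primitive. complex_of_real (N p) powr (- s))"
proof -
  let ?f = "\<lambda>z. complex_of_real (N z) powr (- s)"
  have eq: "?f (case x of (k, p) \<Rightarrow> \<lambda>i. int (Suc k) * p i) =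
      (case x of (k, p) \<Rightarrow> complex_of_nat (Suc k) powr (- s) * ?f p)" for x
  proof (cases x)
    case (Pair k p)
    have "N (\<lambda>i. int (Suc k) * p i) = real (Suc k) * N p"
      by (subst N_mult) simp
    then have "complex_of_real (N (\<lambda>i. int (Suc k) * p i)) = complex_of_nat (Suc k) * complex_of_real (N p)"
      by simp
    then show ?thesis unfolding Pair
      by (simp add: N_def powr_times_real del: of_nat_Suc)
  qed
  have sum: "(\<lambda>x. case x of (k, p) \<Rightarrow> complex_of_nat (Suc k) powr (- s) * ?f p) summable_on (UNIV \<times> primitive)"
    using summable_complex_N[OF s] summable_on_reindex_bij_betw[OF bij_betw_primitive_multiples, of ?f]
    by (simp only: eq)
  have "infsum ?f nonzero_ints = infsum (\<lambda>x. case x of (k, p) \<Rightarrow> complex_of_nat (Suc k) powr (- s) * ?f p) (UNIV \<times> primitive)"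
    using infsum_reindex_bij_betw[OF bij_betw_primitive_multiples, of ?f] by (simp only: eq)
  also have "\<dots> = (\<Sum>\<^sub>\<infinity>k\<in>UNIV. \<Sum>\<^sub>\<infinity>p\<in>primitive. complex_of_nat (Suc k) powr (- s) * ?f p)"
    by (rule infsum_Sigma'_banach[OF sum, symmetric])
  also have "\<dots> = (\<Sum>\<^sub>\<infinity>k\<in>UNIV. complex_of_nat (Suc k) powr (- s)) * infsum ?f primitive"
    by (simp only: infsum_cmult_right' infsum_cmult_left')
  also have "(\<Sum>\<^sub>\<infinity>k\<in>UNIV. complex_of_nat (Suc k) powr (- s)) = riemann_zeta s"
    using s card_ge_2 by (intro infsumI riemann_zeta_has_sum) simp
  finally show ?thesis .
qed

text \<open>Primitive vectors are parallel only when they agree up to sign, so a set without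
  opposite pairs has nonparallel images in the lattice.\<close>

lemma primitive_independent:
  assumes C: "finite C" "C \<subseteq> primitive" and pm: "\<And>p q. p \<in> C \<Longrightarrow> q \<in> C \<Longrightarrow> p \<noteq> q \<Longrightarrow> p \<noteq> (\<lambda>i. - q i)"
    and sum: "(\<Sum>p\<in>C. real_of_int (m p) * ln (N p)) = 0" and p: "p \<in> C"
  shows "m p = 0"
proof -
  let ?e = "\<lambda>z. int_vec z v* g"
  define m' where "m' = (\<lambda>v. m (inv ?e v))"
  have m': "m' (?e z) = m z" for z using inv_f_f[OF inj_lattice, of z] by (simp add: m'_def)
  have "nonparallel (int_vec ` C)"
    unfolding nonparallel_def
  proof
    show "0 \<notin> int_vec ` C"
      using C(2) primitive_nonzero by (force simp: nonzero_ints_def int_vec_def vec_eq_iff fun_eq_iff)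
    show "pairwise (\<lambda>v w. \<forall>c. v \<noteq> c *\<^sub>R w) (int_vec ` C)"
      unfolding pairwise_image
    proof (intro pairwiseI impI allI notI)
      fix p q c assume pq: "p \<in> C" "q \<in> C" "p \<noteq> q" "int_vec p = c *\<^sub>R int_vec q"
      then show False using pm int_vec_parallel_primitive[of p q c] C(2) by blast
    qed
  qed
  then have "nonparallel ((\<lambda>z. z v* g) ` int_vec ` C)" using nonparallel_image_iff[OF SL] by blast
  then have "nonparallel (?e ` C)" by (simp add: image_image)
  moreover have "?e ` C \<subseteq> lattice_of g" using int_vec_in_lattice by auto
  moreover have "(\<Sum>v\<in>?e ` C. real_of_int (m' v) * ln (norm v)) = 0"
    using sum by (subst sum.reindex) (auto simp: m' N_def intro: inj_on_subset[OF inj_lattice])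
  ultimately have "\<forall>v\<in>?e ` C. m' v = 0"
    using independent C(1) unfolding log_independent_def by blast
  then show ?thesis using p m' by auto
qed

text \<open>Only finitely many integer vectors have images no longer than that of the all-ones
  vector. A shortest one is a positive multiple of a primitive vector, which is no longer
  itself.\<close>

lemma minimal_exists: "\<exists>p\<in>primitive. \<forall>z\<in>nonzero_ints. N p \<le> N z"
proof -
  let ?e = "\<lambda>i::'n. 1::int"
  define X where "X = {z \<in> nonzero_ints. N z \<le> N ?e}"
  have "finite X"
  proof -
    obtain a where a: "a > 0" "\<And>z. a * norm (int_vec z) \<le> N z" using N_bounds by metis
    have "z i \<in> {- \<lceil>N ?e / a\<rceil>..\<lceil>N ?e / a\<rceil>}" if "z \<in> X" for z i
    proof -
      have "a * \<bar>real_of_int (z i)\<bar> \<le> a * norm (int_vec z)"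
        using a norm_int_vec_ge[of z i] by (intro mult_left_mono) auto
      also have "\<dots> \<le> N ?e" using a(2)[of z] that by (simp add: X_def)
      finally have "\<bar>real_of_int (z i)\<bar> \<le> N ?e / a" using a by (simp add: field_simps)
      then have "real_of_int \<bar>z i\<bar> \<le> real_of_int \<lceil>N ?e / a\<rceil>" by linarith
      then show ?thesis by auto
    qed
    then have "X \<subseteq> Pi\<^sub>E UNIV (\<lambda>_. {- \<lceil>N ?e / a\<rceil>..\<lceil>N ?e / a\<rceil>})" by fastforce
    then show ?thesis by (rule finite_subset) (intro finite_PiE; simp)
  qed
  moreover have "?e \<in> X" by (simp add: X_def nonzero_ints_def fun_eq_iff)
  then have "X \<noteq> {}" by blast
  ultimately have "Min (N ` X) \<in> N ` X" by (intro Min_in) auto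
  then obtain z0 where z0: "z0 \<in> X" "N z0 = Min (N ` X)" by auto
  have z0_le: "N z0 \<le> N z" if "z \<in> X" for z using z0 that \<open>finite X\<close> by simp
  have min: "N z0 \<le> N z" if "z \<in> nonzero_ints" for z
    using z0(1) z0_le[of z] that by (cases "N z \<le> N ?e") (auto simp: X_def)
  have "z0 \<in> nonzero_ints" using z0 by (simp add: X_def)
  then obtain k p where kp: "p \<in> primitive" "z0 = (\<lambda>i. int (Suc k) * p i)"
    using bij_betw_imp_surj_on[OF bij_betw_primitive_multiples] by (fastforce simp: image_iff)
  have "N z0 = real (Suc k) * N p" unfolding kp(2) by (subst N_mult) simp
  moreover have "1 * N p \<le> real (Suc k) * N p" by (intro mult_right_mono) (auto simp: N_def)
  ultimately have "N p \<le> N z0" by simp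
  then show ?thesis using kp(1) min by (intro bexI[of _ p]) (auto intro: order_trans)
qed

text \<open>The choice is unique up to sign, by \<open>lam_gt_1\<close>.\<close>

definition p0 :: "'n \<Rightarrow> int" where
  "p0 = (SOME p. p \<in> primitive \<and> (\<forall>z\<in>nonzero_ints. N p \<le> N z))"

definition m :: real where
  "m = N p0"

definition I :: "('n \<Rightarrow> int) set" where
  "I = primitive - {p0, \<lambda>i. - p0 i}"

definition lam :: "('n \<Rightarrow> int) \<Rightarrow> real" where
  "lam p = N p / m"

lemma p0: "p0 \<in> primitive" "z \<in> nonzero_ints \<Longrightarrow> m \<le> N z"
  using someI_ex[OF minimal_exists[unfolded Bex_def]] by (auto simp: p0_def[symmetric] m_def)

lemma uminus_p0: "(\<lambda>i. - p0 i) \<in> primitive" "(\<lambda>i. - p0 i) \<noteq> p0"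
proof -
  show "(\<lambda>i. - p0 i) \<in> primitive" by (rule uminus_primitive[OF p0(1)])
  obtain i where "p0 i \<noteq> 0"
    using p0(1) primitive_nonzero by (auto simp: nonzero_ints_def fun_eq_iff)
  then show "(\<lambda>i. - p0 i) \<noteq> p0" by (auto simp: fun_eq_iff)
qed

lemma m_pos: "m > 0"
  unfolding m_def using p0(1) primitive_nonzero by (intro N_pos) auto

lemma I_subset: "I \<subseteq> nonzero_ints" "I \<subseteq> primitive"
  using primitive_nonzero by (auto simp: I_def)

text \<open>Equal lengths of \<open>p\<close> and \<open>p0\<close> would be a logarithmic relation
  with coefficients \<open>1\<close> and \<open>- 1\<close> between nonparallel primitive
  vectors.\<close>

lemma lam_gt_1:
  assumes "p \<in> I"
  shows "lam p > 1"
proof -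
  have "N p \<noteq> m"
  proof
    assume eq: "N p = m"
    have ne: "p \<noteq> p0" "p \<noteq> (\<lambda>i. - p0 i)" using assms by (auto simp: I_def)
    then have ne': "p0 \<noteq> (\<lambda>i. - p i)" by auto
    have "(\<Sum>q\<in>{p, p0}. real_of_int (if q = p then 1 else - 1) * ln (N q)) = 0"
      using ne eq by (simp add: m_def)
    then have "(\<lambda>q. if q = p then 1 else - 1 :: int) p = 0"
      by (rule primitive_independent[rotated 3]) (use assms ne ne' p0(1) in \<open>auto simp: I_def\<close>)
    then show False by simp
  qed
  then have "N p > m" using p0(2)[of p] assms I_subset by force
  then show ?thesis using m_pos by (simp add: lam_def)
qed

text \<open>Since \<open>ln (lam p) = ln (N p) - ln m\<close>, a relation among the
  \<open>ln (lam p)\<close> becomes one among the \<open>ln (N p)\<close> and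
  \<open>ln (N p0)\<close>.\<close>

lemma independent_ln_lam:
  "module.independent (\<lambda>r. (*) (real_of_int r)) ((\<lambda>p. ln (lam p)) ` I)"
proof -
  interpret M: Modules.module "\<lambda>r. (*) (real_of_int r)"
    by (simp add: Modules.module.intro distrib_left mult.commute)
  have "u v = 0" if t: "finite t" "t \<subseteq> (\<lambda>p. ln (lam p)) ` I" and sum: "(\<Sum>v\<in>t. real_of_int (u v) * v) = 0"
    and v: "v \<in> t" for t u v
  proof -
    \<comment> \<open>One index is chosen for each value in \<open>t\<close>; as \<open>p\<close>
      and \<open>- p\<close> have equal \<open>lam\<close>, no opposite pair lies in
      \<open>C\<close>.\<close>
    obtain C where C: "C \<subseteq> I" "inj_on (\<lambda>p. ln (lam p)) C" "t = (\<lambda>p. ln (lam p)) ` C"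
      using t(2) unfolding subset_image_inj by blast
    have "finite C" using C t(1) by (simp add: finite_image_iff)
    have p0C: "p0 \<notin> C" using C by (auto simp: I_def)
    \<comment> \<open>The coefficient at \<open>p0\<close> collects the contributions of all the
      terms \<open>- ln m\<close>.\<close>
    define k where "k = (\<lambda>p. if p = p0 then - (\<Sum>p\<in>C. u (ln (lam p))) else u (ln (lam p)))"
    have kp0: "k p0 = - (\<Sum>p\<in>C. u (ln (lam p)))" by (simp add: k_def)
    have kC: "k p = u (ln (lam p))" if "p \<in> C" for p using that p0C by (auto simp: k_def)
    have pos: "N p > 0" if "p \<in> C" for p using that C I_subset by (intro N_pos) auto
    have ln_lam: "ln (lam p) = ln (N p) - ln m" if "p \<in> C" for p
      using pos[OF that] m_pos by (simp add: lam_def ln_div)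
    have "0 = (\<Sum>p\<in>C. real_of_int (u (ln (lam p))) * ln (lam p))"
      using sum C(2) unfolding C(3) by (simp add: sum.reindex)
    also have "\<dots> = (\<Sum>p\<in>C. real_of_int (u (ln (lam p))) * (ln (N p) - ln m))"
      by (rule sum.cong) (simp_all only: ln_lam)
    also have "\<dots> = (\<Sum>p\<in>C. real_of_int (k p) * ln (N p)) + real_of_int (k p0) * ln (N p0)"
      by (simp add: kC right_diff_distrib sum_subtractf sum_distrib_right kp0 m_def)
    finally have "(\<Sum>p\<in>insert p0 C. real_of_int (k p) * ln (N p)) = 0"
      using \<open>finite C\<close> p0C by simp
    moreover obtain p where p: "p \<in> C" "v = ln (lam p)" using v C by auto
    moreover have "a \<noteq> (\<lambda>i. - b i)" if ab: "a \<in> insert p0 C" "b \<in> insert p0 C" "a \<noteq> b" for a b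
    proof
      assume eq: "a = (\<lambda>i. - b i)"
      then have eq': "b = (\<lambda>i. - a i)" by simp
      show False
      proof (cases "a = p0 \<or> b = p0")
        case True
        then show ?thesis
        proof
          assume "a = p0"
          then show False using ab eq' C(1) uminus_p0(2) by (auto simp: I_def)
        next
          assume "b = p0"
          then show False using ab eq C(1) uminus_p0(2) by (auto simp: I_def)
        qed
      next
        case False
        then have "a \<in> C" "b \<in> C" using ab by auto
        moreover have "lam a = lam b" by (simp add: lam_def eq N_uminus)
        ultimately show ?thesis using inj_onD[OF C(2), of a b] ab(3) by simp
      qed
    qed
    ultimately have "k p = 0"
      using \<open>finite C\<close> C(1) p0(1) by (intro primitive_independent[of "insert p0 C"]) (auto simp: I_def)
    then show ?thesis using p kC by simp
  qed
  then show ?thesis unfolding M.independent_explicit_module by blast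
qed

lemma shortest_length_eq: "shortest_length (lattice_of g) = m"
  unfolding shortest_length_def lattice_minus_0
proof (rule cInf_eq_minimum)
  show "m \<in> norm ` (\<lambda>z. int_vec z v* g) ` nonzero_ints"
    using p0(1) primitive_nonzero by (auto simp: m_def N_def)
qed (use p0(2) in \<open>auto simp: N_def\<close>)

section \<open>The Dirichlet series of the normalized lengths\<close>

lemma sum_primitive:
  assumes s: "Re s > real CARD('n)"
  shows "(\<Sum>\<^sub>\<infinity>p\<in>primitive. complex_of_real (N p) powr (- s)) =
    of_real m powr (- s) * (2 + (\<Sum>\<^sub>\<infinity>p\<in>I. complex_of_real (lam p) powr (- s)))"
proof -
  let ?f = "\<lambda>p. complex_of_real (N p) powr (- s)"
  have sum: "?f summable_on I"
    by (rule summable_on_subset_banach[OF summable_complex_N[OF s] I_subset(1)])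
  have "primitive = {p0, \<lambda>i. - p0 i} \<union> I" using p0(1) uminus_p0 by (auto simp: I_def)
  moreover have "infsum ?f ({p0, \<lambda>i. - p0 i} \<union> I) = infsum ?f {p0, \<lambda>i. - p0 i} + infsum ?f I"
    by (rule infsum_Un_disjoint) (use sum in \<open>auto simp: I_def\<close>)
  ultimately have "infsum ?f primitive = infsum ?f {p0, \<lambda>i. - p0 i} + infsum ?f I" by simp
  also have "infsum ?f {p0, \<lambda>i. - p0 i} = 2 * of_real m powr (- s)"
    using uminus_p0(2) by (simp add: N_uminus m_def)
  also have "infsum ?f I = (\<Sum>\<^sub>\<infinity>p\<in>I. of_real m powr (- s) * of_real (lam p) powr (- s))"
  proof (rule infsum_cong)
    fix p assume p: "p \<in> I"
    have "complex_of_real (N p) = of_real m * of_real (lam p)" using m_pos by (simp add: lam_def)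
    then show "?f p = of_real m powr (- s) * of_real (lam p) powr (- s)"
      using m_pos lam_gt_1[OF p] by (simp add: powr_times_real)
  qed
  also have "\<dots> = of_real m powr (- s) * (\<Sum>\<^sub>\<infinity>p\<in>I. of_real (lam p) powr (- s))"
    by (rule infsum_cmult_right')
  finally show ?thesis by (simp add: algebra_simps)
qed

lemma sum_N:
  assumes s: "Re s > real CARD('n)"
  shows "(\<Sum>\<^sub>\<infinity>z\<in>nonzero_ints. complex_of_real (N z) powr (- s)) =
    riemann_zeta s * (of_real m powr (- s) * (2 + (\<Sum>\<^sub>\<infinity>p\<in>I. complex_of_real (lam p) powr (- s))))"
  by (simp only: zeta_factorization[OF s] sum_primitive[OF s])

lemma summable_lam:
  assumes "\<sigma> > real CARD('n)"
  shows "(\<lambda>p. lam p powr (- \<sigma>)) summable_on I"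
proof -
  have "(\<lambda>p. N p powr (- \<sigma>)) summable_on I"
    by (rule summable_on_subset_banach[OF summable_N[OF assms] I_subset(1)])
  then have "(\<lambda>p. (1 / m powr (- \<sigma>)) * N p powr (- \<sigma>)) summable_on I"
    by (rule summable_on_cmult_right)
  then show ?thesis
    using m_pos by (simp add: lam_def powr_divide N_def)
qed

text \<open>If the series stayed at most 2, the factorization and the bound 2 for zeta would bound
  the full lattice sum by \<open>2 * 4 * m powr (- \<sigma>)\<close>. For a finite subsum one may
  let \<open>\<sigma>\<close> decrease to \<open>n\<close>, which contradicts the divergence at
  exponent \<open>n\<close>.\<close>

lemma sum_lam_exceeds: "\<exists>\<sigma>>real CARD('n). (\<Sum>\<^sub>\<infinity>p\<in>I. lam p powr (- \<sigma>)) > 2"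
proof (rule ccontr)
  define n where "n = real CARD('n)"
  assume neg: "\<not> (\<exists>\<sigma>>real CARD('n). (\<Sum>\<^sub>\<infinity>p\<in>I. lam p powr (- \<sigma>)) > 2)"
  obtain F where F: "finite F" "F \<subseteq> nonzero_ints" "(\<Sum>z\<in>F. N z powr (- n)) > 8 * m powr (- n)"
    unfolding n_def using unbounded_sum_N by blast
  have "(\<Sum>z\<in>F. N z powr (- \<sigma>)) \<le> 8 * m powr (- \<sigma>)" if \<sigma>: "\<sigma> > n" for \<sigma>
  proof -
    define R where "R = (\<Sum>\<^sub>\<infinity>p\<in>I. lam p powr (- \<sigma>))"
    have "R \<le> 2" using neg \<sigma> unfolding R_def n_def by (meson not_less)
    have "R \<ge> 0" by (auto simp: R_def intro!: infsum_nonneg)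
    have pw: "complex_of_real x powr (- of_real \<sigma>) = of_real (x powr (- \<sigma>))" if "x \<ge> 0" for x
      using powr_of_real[OF that, of "- \<sigma>"] by simp
    have "((\<lambda>z. complex_of_real (N z powr (- \<sigma>))) has_sum of_real (\<Sum>\<^sub>\<infinity>z\<in>nonzero_ints. N z powr (- \<sigma>)))
        nonzero_ints"
      using \<sigma> by (intro has_sum_of_real has_sum_infsum summable_N) (simp add: n_def)
    then have N_sum: "(\<Sum>\<^sub>\<infinity>z\<in>nonzero_ints. complex_of_real (N z) powr (- of_real \<sigma>)) =
        of_real (\<Sum>\<^sub>\<infinity>z\<in>nonzero_ints. N z powr (- \<sigma>))"
      by (simp add: pw N_def infsumI)
    have "((\<lambda>p. complex_of_real (lam p powr (- \<sigma>))) has_sum of_real R) I"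
      unfolding R_def using \<sigma> by (intro has_sum_of_real has_sum_infsum summable_lam) (simp add: n_def)
    moreover have "lam p \<ge> 0" for p using m_pos by (simp add: lam_def N_def)
    ultimately have I_sum: "(\<Sum>\<^sub>\<infinity>p\<in>I. complex_of_real (lam p) powr (- of_real \<sigma>)) = of_real R"
      by (simp add: pw infsumI)
    have "complex_of_real (\<Sum>\<^sub>\<infinity>z\<in>nonzero_ints. N z powr (- \<sigma>)) =
        riemann_zeta (of_real \<sigma>) * (of_real (m powr (- \<sigma>)) * (2 + of_real R))"
      using sum_N[of "of_real \<sigma>"] \<sigma> m_pos by (simp add: N_sum I_sum pw n_def)
    then have "norm (complex_of_real (\<Sum>\<^sub>\<infinity>z\<in>nonzero_ints. N z powr (- \<sigma>))) =
        norm (riemann_zeta (of_real \<sigma>)) * (m powr (- \<sigma>) * norm (complex_of_real (2 + R)))"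
      by (simp add: norm_mult)
    also have "\<dots> \<le> 2 * (m powr (- \<sigma>) * 4)"
      using \<open>R \<le> 2\<close> \<open>R \<ge> 0\<close> \<sigma> card_ge_2
      by (intro mult_mono norm_riemann_zeta_le mult_nonneg_nonneg) (auto simp: n_def simp del: of_real_add)
    finally have "(\<Sum>\<^sub>\<infinity>z\<in>nonzero_ints. N z powr (- \<sigma>)) \<le> 8 * m powr (- \<sigma>)" by simp
    moreover have "(\<Sum>z\<in>F. N z powr (- \<sigma>)) \<le> (\<Sum>\<^sub>\<infinity>z\<in>nonzero_ints. N z powr (- \<sigma>))"
      using F \<sigma> by (intro finite_sum_le_infsum summable_N) (auto simp: n_def)
    ultimately show ?thesis by simp
  qed
  then have "\<forall>\<^sub>F \<sigma> in at_right n. (\<Sum>z\<in>F. N z powr (- \<sigma>)) \<le> 8 * m powr (- \<sigma>)"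
    by (auto simp: eventually_at_filter)
  moreover have "((\<lambda>\<sigma>. \<Sum>z\<in>F. N z powr (- \<sigma>)) \<longlongrightarrow> (\<Sum>z\<in>F. N z powr (- n))) (at_right n)"
    using F N_pos by (intro tendsto_intros) force
  moreover have "((\<lambda>\<sigma>. 8 * m powr (- \<sigma>)) \<longlongrightarrow> 8 * m powr (- n)) (at_right n)"
    using m_pos by (intro tendsto_intros) auto
  ultimately have "(\<Sum>z\<in>F. N z powr (- n)) \<le> 8 * m powr (- n)"
    by (intro tendsto_le[of "at_right n"]) auto
  with F(3) show False by simp
qed

sublocale ser: log_independent_series I lam 2 "real CARD('n)"
  by unfold_locales (use lam_gt_1 summable_lam sum_lam_exceeds independent_ln_lam in auto)

section \<open>Zeros of the Epstein zeta function\<close>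

lemma epstein_zeta_eq:
  assumes s: "Re s > real CARD('n) / 2"
  shows "epstein_zeta (lattice_of g) s = riemann_zeta (2 * s) * (of_real m powr (- (2 * s)) * (2 + ser.Z (2 * s)))"
proof -
  have "epstein_zeta (lattice_of g) s = (\<Sum>\<^sub>\<infinity>v\<in>lattice_of g - {0}. complex_of_real (norm v) powr (- 2 * s))"
    using s by (simp add: epstein_zeta_def meromorphic_extension_def)
  also have "\<dots> = (\<Sum>\<^sub>\<infinity>z\<in>nonzero_ints. complex_of_real (N z) powr (- (2 * s)))"
    unfolding lattice_minus_0
    by (subst infsum_reindex) (auto simp: o_def N_def intro: inj_on_subset[OF inj_lattice])
  also have "\<dots> = riemann_zeta (2 * s) * (of_real m powr (- (2 * s)) * (2 + ser.Z (2 * s)))"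
    using s by (subst sum_N) (simp_all add: ser.Z_def)
  finally show ?thesis .
qed

text \<open>Zeta and the power of \<open>m\<close> do not vanish here, which settles the value. As
  for poles, the Epstein zeta function is bounded by \<open>2 * norm (h t)\<close> with
  \<open>h\<close> continuous; if \<open>h\<close> vanishes at \<open>s\<close>, the function tends
  to zero there.\<close>

lemma epstein_zeros_iff:
  assumes s: "Re s > real CARD('n) / 2"
  shows "s \<in> epstein_zeros (lattice_of g) \<longleftrightarrow> 2 + ser.Z (2 * s) = 0"
proof -
  let ?D = "{s. Re s > real CARD('n) / 2}"
  define h where "h = (\<lambda>s. of_real m powr (- (2 * s)) * (2 + ser.Z (2 * s)))"
  have eq: "epstein_zeta (lattice_of g) t = riemann_zeta (2 * t) * h t" if "t \<in> ?D" for t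
    using epstein_zeta_eq[of t] that by (simp add: h_def)
  have zeta: "riemann_zeta (2 * t) \<noteq> 0" "norm (riemann_zeta (2 * t)) \<le> 2" if "t \<in> ?D" for t
    using riemann_zeta_nonzero[of "2 * t"] norm_riemann_zeta_le[of "2 * t"] card_ge_2 that by auto
  have "epstein_zeta (lattice_of g) s = 0 \<longleftrightarrow> 2 + ser.Z (2 * s) = 0"
    using eq[of s] zeta[of s] s m_pos by (simp add: h_def)
  moreover have "\<not> is_pole (epstein_zeta (lattice_of g)) s" if zero: "2 + ser.Z (2 * s) = 0"
  proof
    assume pole: "is_pole (epstein_zeta (lattice_of g)) s"
    have "h holomorphic_on ?D" unfolding h_def
      by (intro holomorphic_intros holomorphic_on_compose_gen[OF _ ser.holomorphic_Z, unfolded o_def])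
        auto
    moreover have "open ?D" by (rule open_halfspace_Re_gt)
    ultimately have "isCont h s"
      using s continuous_on_eq_continuous_at holomorphic_on_imp_continuous_on by blast
    then have "h \<midarrow>s\<rightarrow> 0" using zero by (simp add: isCont_def h_def)
    then have "(\<lambda>t. 2 * norm (h t)) \<midarrow>s\<rightarrow> 0"
      by (intro tendsto_mult_right_zero tendsto_norm_zero)
    moreover have "\<forall>\<^sub>F t in at s. t \<in> ?D"
      using \<open>open ?D\<close> s by (intro eventually_at_in_open') auto
    then have "\<forall>\<^sub>F t in at s. norm (epstein_zeta (lattice_of g) t) \<le> 2 * norm (h t)"
      by (rule eventually_mono) (simp add: eq norm_mult mult_right_mono zeta)
    ultimately have "epstein_zeta (lattice_of g) \<midarrow>s\<rightarrow> 0"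
      by (rule Lim_null_comparison[rotated])
    then show False
      using pole not_tendsto_and_filterlim_at_infinity[of "at s"] by (auto simp: is_pole_def)
  qed
  ultimately show ?thesis by (auto simp: epstein_zeros_def)
qed

text \<open>After cancelling zeta and the power of \<open>m\<close>, the equation reads
  \<open>2 = (2 + R (2 \<sigma>)) / 2\<close>.\<close>

lemma equation_iff:
  assumes \<sigma>: "\<sigma> > real CARD('n) / 2"
  shows "2 * complex_of_real (m powr (- 2 * \<sigma>)) =
      1/2 * inverse (riemann_zeta (of_real (2 * \<sigma>))) * epstein_zeta (lattice_of g) (of_real \<sigma>)
    \<longleftrightarrow> ser.R (2 * \<sigma>) = 2"
proof -
  define x where "x = complex_of_real (m powr (- (2 * \<sigma>)))"
  have "x \<noteq> 0" using m_pos by (simp add: x_def)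
  have zeta: "riemann_zeta (of_real (2 * \<sigma>)) \<noteq> 0"
    using \<sigma> card_ge_2 by (intro riemann_zeta_nonzero) simp
  have "complex_of_real m powr (- (2 * of_real \<sigma>)) = x"
    unfolding x_def using m_pos powr_of_real[of m "- (2 * \<sigma>)"] by simp
  then have "epstein_zeta (lattice_of g) (of_real \<sigma>) =
      riemann_zeta (of_real (2 * \<sigma>)) * (x * (2 + of_real (ser.R (2 * \<sigma>))))"
    using epstein_zeta_eq[of "of_real \<sigma>"] ser.Z_of_real[of "2 * \<sigma>"] \<sigma> by simp
  then have "1/2 * inverse (riemann_zeta (of_real (2 * \<sigma>))) * epstein_zeta (lattice_of g) (of_real \<sigma>) =
      x * ((2 + of_real (ser.R (2 * \<sigma>))) / 2)"
    using zeta by simp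
  moreover have "2 * complex_of_real (m powr (- 2 * \<sigma>)) = x * 2" by (simp add: x_def)
  moreover have "x * 2 = x * ((2 + of_real (ser.R (2 * \<sigma>))) / 2) \<longleftrightarrow> of_real (ser.R (2 * \<sigma>)) = (2 :: complex)"
    using \<open>x \<noteq> 0\<close> by (auto simp: field_simps)
  moreover have "of_real (ser.R (2 * \<sigma>)) = (2 :: complex) \<longleftrightarrow> ser.R (2 * \<sigma>) = 2"
    using of_real_eq_iff[of "ser.R (2 * \<sigma>)" 2, where ?'a = complex] by simp
  ultimately show ?thesis by simp
qed

lemma zeros_near_critical:
  assumes "\<sigma> > real CARD('n)" "ser.R \<sigma> = 2" "\<epsilon> > 0"
  obtains \<rho> where "\<rho> \<in> epstein_zeros (lattice_of g)" "Re \<rho> > real CARD('n) / 2"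
    "Re \<rho> > \<sigma> / 2 - \<epsilon>" "Im \<rho> > T"
proof -
  obtain s where s: "Re s > real CARD('n)" "Re s > \<sigma> - 2 * \<epsilon>" "Im s > 2 * T" "2 + ser.Z s = 0"
    using ser.zeros_near[of \<sigma> "2 * \<epsilon>" "2 * T"] assms by auto
  then show ?thesis
    using that[of "s / 2"] epstein_zeros_iff[of "s / 2"] by simp
qed

text \<open>A finite set is bounded, but there are zeros of arbitrarily large imaginary
  part.\<close>

lemma infinite_zeros: "infinite {\<rho> \<in> epstein_zeros (lattice_of g). Re \<rho> > real CARD('n) / 2}"
proof
  assume "finite {\<rho> \<in> epstein_zeros (lattice_of g). Re \<rho> > real CARD('n) / 2}"
  then have "bounded {\<rho> \<in> epstein_zeros (lattice_of g). Re \<rho> > real CARD('n) / 2}"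
    by (rule finite_imp_bounded)
  then obtain B where B: "\<And>\<rho>. \<rho> \<in> epstein_zeros (lattice_of g) \<Longrightarrow> Re \<rho> > real CARD('n) / 2 \<Longrightarrow> norm \<rho> \<le> B"
    unfolding bounded_iff by blast
  obtain \<sigma> where "\<sigma> > real CARD('n)" "ser.R \<sigma> = 2" by (rule ser.critical_exponent)
  then obtain \<rho> where \<rho>: "\<rho> \<in> epstein_zeros (lattice_of g)" "Re \<rho> > real CARD('n) / 2" "Im \<rho> > B"
    using zeros_near_critical[of \<sigma> 1] by auto
  then show False using B[OF \<rho>(1,2)] abs_Im_le_cmod[of \<rho>] by simp
qed

text \<open>Zeros with real part at most \<open>n / 2\<close> lie below \<open>\<sigma> / 2\<close>
  in any case, the others by the bound for zeros of \<open>2 + Z\<close>; zeros near the critical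
  line show that the bound is sharp.\<close>

lemma epstein_sigma_eq:
  assumes "\<sigma> > real CARD('n)" "ser.R \<sigma> = 2"
  shows "epstein_sigma (lattice_of g) = ereal (\<sigma> / 2)"
  unfolding epstein_sigma_def
proof (rule SUP_eqI)
  fix \<rho> assume \<rho>: "\<rho> \<in> epstein_zeros (lattice_of g)"
  show "ereal (Re \<rho>) \<le> ereal (\<sigma> / 2)"
  proof (cases "Re \<rho> > real CARD('n) / 2")
    case True
    then show ?thesis
      using ser.zero_Re_le[OF assms, of "2 * \<rho>"] epstein_zeros_iff[OF True] \<rho> by simp
  next
    case False
    then show ?thesis using assms by simp
  qed
next
  fix y assume y: "\<And>\<rho>. \<rho> \<in> epstein_zeros (lattice_of g) \<Longrightarrow> ereal (Re \<rho>) \<le> y"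
  show "ereal (\<sigma> / 2) \<le> y"
  proof (rule ereal_le_epsilon2)
    fix e :: real assume "e > 0"
    then obtain \<rho> where \<rho>: "\<rho> \<in> epstein_zeros (lattice_of g)" "Re \<rho> > \<sigma> / 2 - e"
      using zeros_near_critical[OF assms, of e] by metis
    have "ereal (\<sigma> / 2) \<le> ereal (Re \<rho>) + ereal e" using \<rho> by simp
    also have "\<dots> \<le> y + ereal e" by (intro add_right_mono y \<rho>)
    finally show "ereal (\<sigma> / 2) \<le> y + ereal e" .
  qed
qed

text \<open>The equivalence with \<open>\<sigma> = \<sigma>\<^sub>0\<close> expresses existence and
  uniqueness together; uniqueness comes from the strict decrease of \<open>R\<close>.\<close>

lemma unique_solution:
  "\<exists>\<sigma>\<^sub>0::real. (\<forall>\<sigma>::real.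
      (\<sigma> > real CARD('n) / 2 \<and>
       2 * complex_of_real (shortest_length (lattice_of g) powr (- 2 * \<sigma>)) =
         1/2 * inverse (riemann_zeta (of_real (2 * \<sigma>))) * epstein_zeta (lattice_of g) (of_real \<sigma>))
      \<longleftrightarrow> \<sigma> = \<sigma>\<^sub>0) \<and>
    epstein_sigma (lattice_of g) = ereal \<sigma>\<^sub>0"
proof -
  obtain \<tau> where \<tau>: "\<tau> > real CARD('n)" "ser.R \<tau> = 2" by (rule ser.critical_exponent)
  have unique: "\<sigma> = \<tau>" if "\<sigma> > real CARD('n)" "ser.R \<sigma> = 2" for \<sigma>
    using ser.R_strict_antimono[of \<sigma> \<tau>] ser.R_strict_antimono[of \<tau> \<sigma>] that \<tau>
    by (cases \<sigma> \<tau> rule: linorder_cases) auto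
  have "(\<sigma> > real CARD('n) / 2 \<and>
       2 * complex_of_real (m powr (- 2 * \<sigma>)) =
         1/2 * inverse (riemann_zeta (of_real (2 * \<sigma>))) * epstein_zeta (lattice_of g) (of_real \<sigma>))
      \<longleftrightarrow> \<sigma> = \<tau> / 2" for \<sigma>
  proof (cases "\<sigma> > real CARD('n) / 2")
    case True
    then have "ser.R (2 * \<sigma>) = 2 \<longleftrightarrow> 2 * \<sigma> = \<tau>" using unique[of "2 * \<sigma>"] \<tau> by auto
    then show ?thesis unfolding equation_iff[OF True] using True by auto
  next
    case False
    then show ?thesis using \<tau> by auto
  qed
  then show ?thesis
    unfolding shortest_length_eq using epstein_sigma_eq[OF \<tau>] by blast
qed

end

section \<open>From generic lattices to almost every lattice\<close>

theorem proposition1: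
  fixes \<mu> :: "(real^'n) set measure"
  assumes "CARD('n) \<ge> 2" and "siegel_measure \<mu>"
  shows "(AE L in \<mu>. \<exists>\<sigma>\<^sub>0::real.
            (\<forall>\<sigma>::real.
               (\<sigma> > real CARD('n) / 2 \<and>
                2 * complex_of_real (shortest_length L powr (- 2 * \<sigma>)) =
                  1/2 * inverse (riemann_zeta (of_real (2 * \<sigma>))) * epstein_zeta L (of_real \<sigma>))
               \<longleftrightarrow> \<sigma> = \<sigma>\<^sub>0) \<and>
            epstein_sigma L = ereal \<sigma>\<^sub>0) \<and>
         (AE L in \<mu>. infinite {\<rho> \<in> epstein_zeros L. Re \<rho> > real CARD('n) / 2})"
proof -
  have generic: "AE L in \<mu>. \<exists>g. generic_lattice g \<and> L = lattice_of g"
  proof (rule eventually_mono[OF AE_siegel_measure_log_independent[OF assms(2,1)]])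
    fix L :: "(real^'n) set"
    assume L: "L \<in> unimodular_lattices \<and> log_independent L"
    then obtain g where "g \<in> SL" "L = lattice_of g" by (auto simp: unimodular_lattices_def)
    with L assms(1) show "\<exists>g. generic_lattice g \<and> L = lattice_of g"
      by (auto simp: generic_lattice_def)
  qed
  show ?thesis
  proof (intro conjI)
    show "AE L in \<mu>. \<exists>\<sigma>\<^sub>0::real.
            (\<forall>\<sigma>::real.
               (\<sigma> > real CARD('n) / 2 \<and>
                2 * complex_of_real (shortest_length L powr (- 2 * \<sigma>)) =
                  1/2 * inverse (riemann_zeta (of_real (2 * \<sigma>))) * epstein_zeta L (of_real \<sigma>))
               \<longleftrightarrow> \<sigma> = \<sigma>\<^sub>0) \<and>
            epstein_sigma L = ereal \<sigma>\<^sub>0"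
      by (rule eventually_mono[OF generic]) (auto simp only: dest: generic_lattice.unique_solution)
    show "AE L in \<mu>. infinite {\<rho> \<in> epstein_zeros L. Re \<rho> > real CARD('n) / 2}"
      by (rule eventually_mono[OF generic]) (auto simp only: dest: generic_lattice.infinite_zeros)
  qed
qed

end
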